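(* Let $p$ be a prime number, $(K,|\cdot|)$ an algebraically closed ultrametric field of residue characteristic $p$, and $q\ge1$ an integer not divisible by $p$. (1) Let $\lambda\in K$ with $|\lambda|=1$ such that the order of $\widetilde\lambda$ in $\widetilde K^*$ is $q$. Let $n\ge1$ be an integer and $P(z)=\lambda z+\cdots$ a polynomial in $\mathcal{O}_K[z]$ having an optimal cycle of period $qp^n$. Then this is the only cycle of minimal period $qp^n$ of $P$; if $p$ is odd, the reduction of $P$ is minimally ramified; if $p=2$ and $n\ge2$, the reduction of $P$ is minimally ramified or almost minimally ramified. (2) Let $F$ be the prime field of $K$, $\gamma\in\widetilde K$ a root of unity of order $q$, and $g(\zeta)=\gamma\zeta+\cdots\in\widetilde K[\zeta]$ a polynomial that is minimally ramified if $p$ is odd, and minimally ramified or almost minimally ramified if $p=2$. Then for all integers $n\ge1$ and $d\ge\max\{\deg(g),p\}$ there is a nonzero polynomial $R_n(\alpha_1,\dots,\alpha_d)\in F[\alpha_1,\dots,\alpha_d]$ such that: if $a_1,\dots,a_d\in\mathcal{O}_K$ are such that the reduction of $P(z)=a_1z+\cdots+a_dz^d$ is $g$ and $R_n(a_1,\dots,a_d)\ne0$, then $P$ has an optimal cycle of period $qp^n$.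
   Context: $\mathcal{O}_K=\{|z|\le1\}$, $\mathfrak{m}_K=\{|z|<1\}$, $\widetilde K=\mathcal{O}_K/\mathfrak{m}_K$; reductions are coefficientwise. Periodic points are considered in $\mathfrak{m}_K$. For $f(z)=\lambda z+\cdots\in\mathcal{O}_K[[z]]$ with $|\lambda|=1$, $\widetilde\lambda$ of order $q$, and $n\ge1$ with $\lambda^{qp^n}\ne1$, $f$ has an optimal cycle of period $qp^n$ if it has a periodic point $z_0$ of minimal period $qp^n$ with $|z_0|=\left|\frac{\lambda^{qp^n}-1}{\lambda^{qp^{n-1}}-1}\right|^{1/(qp^n)}$. For a field $k$ of characteristic $p$, $\mathrm{ord}$ is the lowest degree of a nonzero term in $k[[\zeta]]$; for $h(\zeta)=\zeta+\cdots$, $i_n(h)=\mathrm{ord}\big((h^{p^n}(\zeta)-\zeta)/\zeta\big)$. For a root of unity $\gamma\in k$ of order $q$, $g(\zeta)=\gamma\zeta+\cdots$ is minimally ramified if $i_n(g^q)=q\frac{p^{n+1}-1}{p-1}$ for all $n\ge0$, and (when $p=2$) almost minimally ramified if $i_n(g^q)=2^{n+1}q$ for all $n\ge0$. *)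

theory Defs
  imports "HOL-Computational_Algebra.Polynomial" "HOL-Analysis.Analysis"
begin

definition ultrametric_abs :: "('a::field \<Rightarrow> real) \<Rightarrow> bool" where
  "ultrametric_abs v \<longleftrightarrow>
     (\<forall>x. v x \<ge> 0) \<and> (\<forall>x. v x = 0 \<longleftrightarrow> x = 0) \<and>
     (\<forall>x y. v (x * y) = v x * v y) \<and> (\<forall>x y. v (x + y) \<le> max (v x) (v y))"

text \<open>red is a reduction map O_K -> residue field: a surjective ring homomorphism on the
  valuation ring O_K = {|z| <= 1} with kernel the maximal ideal m_K = {|z| < 1}.
  This determines the residue field up to isomorphism.\<close>
definition residue_map :: "('a::field \<Rightarrow> real) \<Rightarrow> ('a \<Rightarrow> 'k::field) \<Rightarrow> bool" where
  "residue_map v red \<longleftrightarrow>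
     red 1 = 1 \<and>
     (\<forall>x y. v x \<le> 1 \<longrightarrow> v y \<le> 1 \<longrightarrow> red (x + y) = red x + red y) \<and>
     (\<forall>x y. v x \<le> 1 \<longrightarrow> v y \<le> 1 \<longrightarrow> red (x * y) = red x * red y) \<and>
     (\<forall>x. v x \<le> 1 \<longrightarrow> (red x = 0 \<longleftrightarrow> v x < 1)) \<and>
     (\<forall>y. \<exists>x. v x \<le> 1 \<and> red x = y)"

definition has_order :: "'a::field \<Rightarrow> nat \<Rightarrow> bool" where
  "has_order g q \<longleftrightarrow> q > 0 \<and> g ^ q = 1 \<and> (\<forall>j. 0 < j \<and> j < q \<longrightarrow> g ^ j \<noteq> 1)"

definition min_period :: "('a \<Rightarrow> 'a) \<Rightarrow> 'a \<Rightarrow> nat \<Rightarrow> bool" where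
  "min_period f z m \<longleftrightarrow> m > 0 \<and> (f ^^ m) z = z \<and> (\<forall>j. 0 < j \<and> j < m \<longrightarrow> (f ^^ j) z \<noteq> z)"

definition optimal_point ::
  "('a::field \<Rightarrow> real) \<Rightarrow> 'a poly \<Rightarrow> nat \<Rightarrow> nat \<Rightarrow> nat \<Rightarrow> 'a \<Rightarrow> bool" where
  "optimal_point v P q p n z0 \<longleftrightarrow>
     (let lam = coeff P 1 in
       lam ^ (q * p ^ n) \<noteq> 1 \<and> v z0 < 1 \<and> min_period (poly P) z0 (q * p ^ n) \<and>
       v z0 = (v (lam ^ (q * p ^ n) - 1) / v (lam ^ (q * p ^ (n - 1)) - 1))
                powr (1 / real (q * p ^ n)))"

definition has_optimal_cycle ::
  "('a::field \<Rightarrow> real) \<Rightarrow> 'a poly \<Rightarrow> nat \<Rightarrow> nat \<Rightarrow> nat \<Rightarrow> bool" where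
  "has_optimal_cycle v P q p n \<longleftrightarrow> (\<exists>z0. optimal_point v P q p n z0)"

definition poly_iter :: "'k::comm_ring_1 poly \<Rightarrow> nat \<Rightarrow> 'k poly" where
  "poly_iter h m = ((\<lambda>f. pcompose h f) ^^ m) [:0, 1:]"

text \<open>i_n(h) = ord((h^{p^n}(zeta) - zeta)/zeta); the i-th coefficient of (H - zeta)/zeta
  is the (i+1)-th coefficient of H - zeta (H has zero constant term).\<close>
definition ram_index :: "nat \<Rightarrow> 'k::field poly \<Rightarrow> nat \<Rightarrow> nat" where
  "ram_index p h n = (LEAST i. coeff (poly_iter h (p ^ n) - [:0, 1:]) (Suc i) \<noteq> 0)"

definition minimally_ramified :: "nat \<Rightarrow> nat \<Rightarrow> 'k::field poly \<Rightarrow> bool" where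
  "minimally_ramified p q g \<longleftrightarrow>
     (\<forall>n. ram_index p (poly_iter g q) n = q * ((p ^ (n + 1) - 1) div (p - 1)))"

definition almost_minimally_ramified :: "nat \<Rightarrow> 'k::field poly \<Rightarrow> bool" where
  "almost_minimally_ramified q g \<longleftrightarrow>
     (\<forall>n. ram_index 2 (poly_iter g q) n = 2 ^ (n + 1) * q)"

definition prime_subfield :: "'a::field set" where
  "prime_subfield = {x. \<exists>m n :: int. x = of_int m / of_int n}"

text \<open>Polynomials in d variables alpha_1..alpha_d: coefficient functions on exponent
  vectors e (supported on {1..d}), finitely many nonzero coefficients.\<close>
definition is_mpoly_over :: "'a set \<Rightarrow> nat \<Rightarrow> ((nat \<Rightarrow> nat) \<Rightarrow> 'a::field) \<Rightarrow> bool" where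
  "is_mpoly_over F d R \<longleftrightarrow>
     finite {e. R e \<noteq> 0} \<and>
     (\<forall>e. R e \<noteq> 0 \<longrightarrow> (\<forall>i. i \<notin> {1..d} \<longrightarrow> e i = 0)) \<and>
     (\<forall>e. R e \<in> F)"

definition mpoly_eval :: "nat \<Rightarrow> ((nat \<Rightarrow> nat) \<Rightarrow> 'a::field) \<Rightarrow> (nat \<Rightarrow> 'a) \<Rightarrow> 'a" where
  "mpoly_eval d R a = (\<Sum>e\<in>{e. R e \<noteq> 0}. R e * (\<Prod>i\<in>{1..d}. a i ^ e i))"

end

theory Submission
  imports Defs
    "HOL-Computational_Algebra.Polynomial_FPS"
    "HOL-Number_Theory.Cong"
    "Jordan_Normal_Form.Determinant"
begin

text \<open>On the open unit disk, the quotient C of f^{qp^n} - z by f^{qp^{n-1}} - z has as many roots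
  as the order of vanishing of its reduction, and the product of their absolute values is at
  least |C(0)|, with equality if and only if C does not reduce to 0. A point of an optimal cycle
  satisfies |z0|^{qp^n} = |C(0)|, so the cycle consists of all these roots; hence it is unique and
  the ramification numbers of the reduction satisfy i_n - i_{n-1} = qp^n. Conversely, if this
  difference is qp^n and all periodic points are simple, the roots form a single cycle, on which
  |z| is constant, so the cycle is optimal. Simplicity is the nonvanishing of a resultant.

  It remains to see that i_n - i_{n-1} = qp^n for one n determines all ramification numbers.
  Passing to the quotient by the semisimple part of g reduces this to q = 1. Put
  D f = f o h - f; then h^p - z = D^p z in characteristic p, and following the two lowest
  coefficients through the p applications of D gives lower bounds for i_{n+1} in terms of i_n,
  and shows that i_{n+1} is minimal exactly when the second coefficient b_n of h^{p^n} - z is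
  nonzero (up to a correction for n = 0). Since h^{p^n} and h^{p^{n+1}} commute, b_{n+1} is then nonzero as well.\<close>

section \<open>Ramification numbers of iterates of power series\<close>

text \<open>The restriction n >= 2 for p = 2 comes from the passage from h to h^p: its second
  coefficient involves \<open>p choose 2\<close>, which is 0 in the field only for odd p. From level
  1 on the series is tangent to higher order and the quadratic correction disappears. The semisimple
  part of g exists only as a limit of iterates g^(p^N) with p^N = 1 mod q. No limit is taken: a
  ramification number depends on finitely many coefficients, so one such iterate and congruences
  modulo X^M suffice, at the price of a quotient series that depends on M. The resultant must be a
  nonzero polynomial in the coefficients, which requires one polynomial of degree d with no
  multiplier 1 among the points fixed by its N-th iterate. The map (z + b)^d - b^d serves for large
  |b|, in any characteristic of K, including those that divide d. Its coefficients may lie outside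
  O_K, since only the nonvanishing of a polynomial over the prime field matters. An element with |b|
  > 1 exists unless the absolute value is trivial; that case is settled separately, as the maximal
  ideal is then 0.\<close>

definition fps_iter :: "'a::comm_ring_1 fps \<Rightarrow> nat \<Rightarrow> 'a fps" where
  "fps_iter F m = ((\<lambda>f. F oo f) ^^ m) fps_X"

lemma fps_iter_0 [simp]: "fps_iter F 0 = fps_X"
  by (simp add: fps_iter_def)

lemma fps_iter_Suc: "fps_iter F (Suc m) = F oo fps_iter F m"
  by (simp add: fps_iter_def)

text \<open>This says ord((H - z)/z) >= i together with multiplier 1. An index i of this kind goes
  with the coefficient of degree i + 1, a shift that recurs throughout.\<close>

definition tangent :: "nat \<Rightarrow> 'a::comm_ring_1 fps \<Rightarrow> bool" where
  "tangent i H \<longleftrightarrow> fps_nth H 0 = 0 \<and> fps_nth H 1 = 1 \<and> (\<forall>j. 1 < j \<and> j \<le> i \<longrightarrow> fps_nth H j = 0)"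

lemma power_one_plus_expand:
  fixes u :: "'a::comm_ring_1"
  shows "\<exists>e. (1 + u) ^ s = 1 + of_nat s * u + of_nat (s choose 2) * u ^ 2 + u ^ 3 * e"
proof (induction s)
  case 0
  then show ?case by (auto intro!: exI[of _ 0] simp: binomial_eq_0)
next
  case (Suc s)
  then obtain e where e: "(1 + u) ^ s = 1 + of_nat s * u + of_nat (s choose 2) * u ^ 2 + u ^ 3 * e"
    by blast
  have ch: "Suc s choose 2 = s + (s choose 2)"
    by (simp add: numeral_2_eq_2)
  have "(1 + u) ^ Suc s = (1 + u) * (1 + of_nat s * u + of_nat (s choose 2) * u ^ 2 + u ^ 3 * e)"
    using e by simp
  also have "\<dots> = 1 + of_nat (Suc s) * u + of_nat (Suc s choose 2) * u ^ 2
                + u ^ 3 * (e * (1 + u) + of_nat (s choose 2))"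
    unfolding ch by (simp add: algebra_simps power2_eq_square power3_eq_cube)
  finally show ?case by blast
qed

text \<open>Write H = X (1 + X^i w) and expand the s-th power. The quadratic term starts at relative
  degree 2i, so it reaches relative degree i + 1 only for i = 1; this is the origin of every
  \<open>if i = 1\<close> correction below.\<close>

lemma tangent_power:
  fixes H :: "'a::comm_ring_1 fps"
  assumes "tangent i H" "i \<ge> 1"
  shows "n < s + i \<Longrightarrow> fps_nth (H ^ s) n = (if n = s then 1 else 0)"
    and "fps_nth (H ^ s) (s + i) = of_nat s * fps_nth H (i + 1)"
    and "fps_nth (H ^ s) (s + i + 1) = of_nat s * fps_nth H (i + 2) +
           (if i = 1 then of_nat (s choose 2) * fps_nth H 2 ^ 2 else 0)"
proof -
  define w where "w = fps_shift (i + 1) H"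
  have H: "H = fps_X * (1 + fps_X ^ i * w)"
  proof (rule fps_ext)
    fix n
    show "fps_nth H n = fps_nth (fps_X * (1 + fps_X ^ i * w)) n"
      using assms unfolding tangent_def
      by (cases n) (auto simp: w_def fps_X_power_mult_nth)
  qed
  obtain e where e: "(1 + fps_X ^ i * w) ^ s =
      1 + of_nat s * (fps_X ^ i * w) + of_nat (s choose 2) * (fps_X ^ i * w) ^ 2 + (fps_X ^ i * w) ^ 3 * e"
    using power_one_plus_expand by blast
  have Hs: "H ^ s = fps_X ^ s * (1 + fps_X ^ i * (fps_const (of_nat s) * w)
      + fps_X ^ (2 * i) * (fps_const (of_nat (s choose 2)) * w ^ 2) + fps_X ^ (3 * i) * (w ^ 3 * e))"
    unfolding H power_mult_distrib e
    by (simp add: algebra_simps power_mult_distrib power_mult[symmetric] fps_of_nat)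
  have w0: "fps_nth w 0 = fps_nth H (i + 1)" "fps_nth w (Suc 0) = fps_nth H (i + 2)"
    by (simp_all add: w_def)
  show "n < s + i \<Longrightarrow> fps_nth (H ^ s) n = (if n = s then 1 else 0)"
    unfolding Hs by (auto simp: fps_X_power_mult_nth)
  show "fps_nth (H ^ s) (s + i) = of_nat s * fps_nth H (i + 1)"
    unfolding Hs using assms(2) by (auto simp: fps_X_power_mult_nth w0)
  show "fps_nth (H ^ s) (s + i + 1) = of_nat s * fps_nth H (i + 2) +
           (if i = 1 then of_nat (s choose 2) * fps_nth H 2 ^ 2 else 0)"
    unfolding Hs using assms(2) by (auto simp: fps_X_power_mult_nth w0 power2_eq_square numeral_2_eq_2)
qed

text \<open>The difference is the sum of the f_j (H^j - X^j), whose j-th term starts in degree j + i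
  at the earliest. Hence the first coefficient sees only j = s, and the second only j = s and j = s
  + 1.\<close>

lemma compose_diff_coeffs:
  fixes H f :: "'a::comm_ring_1 fps"
  assumes H: "tangent i H" "i \<ge> 1" and f: "\<And>j. j < s \<Longrightarrow> fps_nth f j = 0"
  shows "n < s + i \<Longrightarrow> fps_nth ((f oo H) - f) n = 0"
    and "fps_nth ((f oo H) - f) (s + i) = of_nat s * fps_nth f s * fps_nth H (i + 1)"
    and "fps_nth ((f oo H) - f) (s + i + 1) =
           fps_nth f s * (of_nat s * fps_nth H (i + 2) +
             (if i = 1 then of_nat (s choose 2) * fps_nth H 2 ^ 2 else 0))
           + of_nat (s + 1) * fps_nth f (s + 1) * fps_nth H (i + 1)"
proof -
  have *: "fps_nth ((f oo H) - f) n = (\<Sum>j\<in>{0..n}. fps_nth f j * (fps_nth (H ^ j) n - (if n = j then 1 else 0)))" for n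
  proof -
    have "fps_nth f n = (\<Sum>j\<in>{0..n}. fps_nth f j * (if n = j then 1 else 0))"
      by (simp add: if_distrib sum.delta cong: if_cong)
    then show ?thesis
      by (simp add: fps_compose_nth right_diff_distrib sum_subtractf)
  qed
  have z: "fps_nth f j * (fps_nth (H ^ j) n - (if n = j then 1 else 0)) = 0" if "n < j + i \<or> j < s" for j n
    using that tangent_power(1)[OF H, of n j] f[of j] by auto
  show "n < s + i \<Longrightarrow> fps_nth ((f oo H) - f) n = 0"
    unfolding * by (intro sum.neutral ballI z) auto
  have "fps_nth ((f oo H) - f) (s + i) = (\<Sum>j\<in>{s}. fps_nth f j * (fps_nth (H ^ j) (s + i) - (if s + i = j then 1 else 0)))"
    unfolding * by (rule sum.mono_neutral_right; use H(2) in \<open>(intro ballI z)?; auto\<close>)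
  then show "fps_nth ((f oo H) - f) (s + i) = of_nat s * fps_nth f s * fps_nth H (i + 1)"
    using tangent_power(2)[OF H, of s] H(2) by simp
  have "fps_nth ((f oo H) - f) (s + i + 1) = (\<Sum>j\<in>{s, s + 1}. fps_nth f j * (fps_nth (H ^ j) (s + i + 1) - (if s + i + 1 = j then 1 else 0)))"
    unfolding * by (rule sum.mono_neutral_right; use H(2) in \<open>(intro ballI z)?; auto\<close>)
  moreover have "fps_nth (H ^ (s + 1)) (s + i + 1) = of_nat (s + 1) * fps_nth H (i + 1)"
    using tangent_power(2)[OF H, of "s + 1"] by (simp add: algebra_simps)
  ultimately show "fps_nth ((f oo H) - f) (s + i + 1) =
           fps_nth f s * (of_nat s * fps_nth H (i + 2) +
             (if i = 1 then of_nat (s choose 2) * fps_nth H 2 ^ 2 else 0))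
           + of_nat (s + 1) * fps_nth f (s + 1) * fps_nth H (i + 1)"
    using tangent_power(3)[OF H, of s] H(2) by (simp add: mult_ac)
qed

text \<open>For commuting series, composing the two nonlinear parts with the other series gives
  the same increment; comparing its first two coefficients yields the constraints.\<close>
lemma commuting_coeffs:
  fixes H G :: "'a::field fps"
  assumes H: "tangent i H" "i \<ge> 1" and G: "tangent l G" "l \<ge> 1"
    and comm: "H oo G = G oo H"
  shows "of_nat i * (fps_nth H (i + 1) * fps_nth G (l + 1)) =
           of_nat l * (fps_nth H (i + 1) * fps_nth G (l + 1))"
    and "fps_nth H (i + 1) * (of_nat (i + 1) * fps_nth G (l + 2) +
             (if l = 1 then of_nat ((i + 1) choose 2) * fps_nth G 2 ^ 2 else 0))
           + of_nat (i + 2) * fps_nth H (i + 2) * fps_nth G (l + 1) =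
         fps_nth G (l + 1) * (of_nat (l + 1) * fps_nth H (i + 2) +
             (if i = 1 then of_nat ((l + 1) choose 2) * fps_nth H 2 ^ 2 else 0))
           + of_nat (l + 2) * fps_nth G (l + 2) * fps_nth H (i + 1)"
proof -
  have G0: "fps_nth G 0 = 0" "fps_nth H 0 = 0"
    using G H by (auto simp: tangent_def)
  have eq: "((H - fps_X) oo G) - (H - fps_X) = ((G - fps_X) oo H) - (G - fps_X)"
    using comm G0 by (simp add: fps_compose_sub_distrib)
  have nz: "fps_nth (H - fps_X) j = 0" if "j < i + 1" for j
    using H that by (cases "j = 0"; cases "j = 1") (auto simp: tangent_def fps_X_def)
  have nzG: "fps_nth (G - fps_X) j = 0" if "j < l + 1" for j
    using G that by (cases "j = 0"; cases "j = 1") (auto simp: tangent_def fps_X_def)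
  have cf: "fps_nth (H - fps_X) j = fps_nth H j" "fps_nth (G - fps_X) j = fps_nth G j" if "j > 1" for j
    using that by (auto simp: fps_X_def)
  note a = compose_diff_coeffs[OF G, of "i + 1" "H - fps_X", OF nz]
  note b = compose_diff_coeffs[OF H, of "l + 1" "G - fps_X", OF nzG]
  have e: "i + 1 + l = l + 1 + i" by simp
  have "of_nat (i + 1) * fps_nth H (i + 1) * fps_nth G (l + 1) = of_nat (l + 1) * fps_nth G (l + 1) * fps_nth H (i + 1)"
    using a(2) b(2)[folded eq e] H(2) G(2) by (simp add: cf del: of_nat_Suc of_nat_add)
  then show "of_nat i * (fps_nth H (i + 1) * fps_nth G (l + 1)) =
           of_nat l * (fps_nth H (i + 1) * fps_nth G (l + 1))"
    by (simp add: algebra_simps)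
  have e1: "i + 1 + 1 = i + 2" "l + 1 + 1 = l + 2" by simp_all
  show "fps_nth H (i + 1) * (of_nat (i + 1) * fps_nth G (l + 2) +
             (if l = 1 then of_nat ((i + 1) choose 2) * fps_nth G 2 ^ 2 else 0))
           + of_nat (i + 2) * fps_nth H (i + 2) * fps_nth G (l + 1) =
         fps_nth G (l + 1) * (of_nat (l + 1) * fps_nth H (i + 2) +
             (if i = 1 then of_nat ((l + 1) choose 2) * fps_nth H 2 ^ 2 else 0))
           + of_nat (l + 2) * fps_nth G (l + 2) * fps_nth H (i + 1)"
    using a(3) b(3)[folded eq e] H(2) G(2) unfolding e1
    by (simp add: cf del: of_nat_Suc of_nat_add)
qed

lemma prime_dvd_choose:
  assumes "prime (p::nat)" "0 < k" "k < p"
  shows "p dvd (p choose k)"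
proof -
  have "p dvd k * (p choose k)"
    using assms(2) times_binomial_minus1_eq[of k p] by simp
  then show ?thesis
    using assms prime_dvd_mult_iff nat_dvd_not_less by blast
qed

lemma fps_iter_nth_0: "fps_nth F 0 = 0 \<Longrightarrow> fps_nth (fps_iter F m) 0 = 0"
  by (cases m) (simp_all add: fps_iter_Suc)

lemma fps_iter_add:
  fixes F :: "'a::idom fps"
  assumes "fps_nth F 0 = 0"
  shows "fps_iter F (m + n) = fps_iter F m oo fps_iter F n"
  using assms by (induction m) (simp_all add: fps_iter_Suc fps_iter_nth_0 fps_compose_assoc)

lemma fps_iter_1: "fps_iter F (Suc 0) = F"
  by (simp add: fps_iter_Suc)

lemma fps_iter_mult:
  fixes F :: "'a::idom fps"
  assumes "fps_nth F 0 = 0"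
  shows "fps_iter F (m * n) = fps_iter (fps_iter F m) n"
  using assms by (induction n) (simp_all add: fps_iter_Suc fps_iter_add)

lemma fps_iter_commute:
  fixes F :: "'a::idom fps"
  assumes "fps_nth F 0 = 0"
  shows "fps_iter F m oo fps_iter F n = fps_iter F n oo fps_iter F m"
  using fps_iter_add[OF assms, of m n] fps_iter_add[OF assms, of n m] by (simp add: add.commute)

text \<open>The operator D of the overview. Composition with H is id + D, which is why iterates of H
  obey a binomial expansion.\<close>

definition incr :: "'a::comm_ring_1 fps \<Rightarrow> 'a fps \<Rightarrow> 'a fps" where
  "incr H f = (f oo H) - f"

lemma incr_pow_Suc: "(incr H ^^ Suc t) f = (((incr H ^^ t) f) oo H) - (incr H ^^ t) f"
  by (simp add: incr_def)

lemma compose_iter_binomial: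
  fixes H f :: "'a::idom fps"
  assumes "fps_nth H 0 = 0"
  shows "f oo fps_iter H m = (\<Sum>j\<le>m. of_nat (m choose j) * (incr H ^^ j) f)"
proof (induction m)
  case 0
  then show ?case by simp
next
  case (Suc m)
  define x where "x j = (incr H ^^ j) f" for j
  have x: "x j oo H = x j + x (Suc j)" for j
    by (simp add: x_def incr_def)
  have "fps_iter H (Suc m) = fps_iter H m oo H"
    using fps_iter_add[OF assms, of m "Suc 0"] by (simp add: fps_iter_1)
  then have "f oo fps_iter H (Suc m) = (\<Sum>j\<le>m. of_nat (m choose j) * x j) oo H"
    using Suc assms by (simp add: fps_compose_assoc fps_iter_nth_0 x_def)
  also have "\<dots> = (\<Sum>j\<le>m. of_nat (m choose j) * (x j + x (Suc j)))"
    by (simp add: fps_compose_sum_distrib fps_compose_mult_distrib assms x flip: fps_of_nat)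
  also have "\<dots> = (\<Sum>j\<le>m. of_nat (m choose j) * x j) + (\<Sum>j\<le>m. of_nat (m choose j) * x (Suc j))"
    by (simp add: distrib_left sum.distrib)
  also have "(\<Sum>j\<le>m. of_nat (m choose j) * x j) = (\<Sum>j\<le>Suc m. of_nat (m choose j) * x j)"
    by (simp add: binomial_eq_0)
  also have "\<dots> = x 0 + (\<Sum>j\<le>m. of_nat (m choose Suc j) * x (Suc j))"
    by (subst sum.atMost_Suc_shift) simp
  also have "\<dots> + (\<Sum>j\<le>m. of_nat (m choose j) * x (Suc j)) =
      x 0 + (\<Sum>j\<le>m. of_nat (Suc m choose Suc j) * x (Suc j))"
    unfolding add.assoc sum.distrib[symmetric] by (simp add: distrib_right add.commute)
  also have "\<dots> = (\<Sum>j\<le>Suc m. of_nat (Suc m choose j) * x j)"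
    by (subst sum.atMost_Suc_shift) (simp del: binomial_Suc_Suc)
  finally show ?case by (simp add: x_def)
qed

text \<open>(id + D)^p = id + D^p, since the inner binomial coefficients vanish in characteristic
  p.\<close>

lemma compose_iter_prime:
  fixes H f :: "'a::field fps"
  assumes "fps_nth H 0 = 0" "prime p" "CHAR('a) = p"
  shows "f oo fps_iter H p = f + (incr H ^^ p) f"
proof -
  have "of_nat (p choose j) = (0 :: 'a fps)" if "j \<in> {..p} - {0, p}" for j
  proof -
    have "p dvd (p choose j)"
      using that assms(2) by (intro prime_dvd_choose) auto
    then have "of_nat (p choose j) = (0 :: 'a)"
      using assms(3) of_nat_eq_0_iff_char_dvd by blast
    then show ?thesis by (simp flip: fps_of_nat)
  qed
  then have "f oo fps_iter H p = (\<Sum>j\<in>{0, p}. of_nat (p choose j) * (incr H ^^ j) f)"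
    unfolding compose_iter_binomial[OF assms(1)] by (intro sum.mono_neutral_right) auto
  then show ?thesis using assms(2) by (simp add: prime_gt_0_nat)
qed

text \<open>Each application of D raises the order by i and multiplies the leading coefficient by
  its current degree 1 + r i, besides the leading coefficient of H. The product of these degrees
  decides whether the p-th power of D gains extra order.\<close>

lemma incr_pow_X_coeffs:
  fixes H :: "'a::field fps"
  assumes H: "tangent i H" "i \<ge> 1"
  shows "j < 1 + t * i \<Longrightarrow> fps_nth ((incr H ^^ t) fps_X) j = 0"
    and "fps_nth ((incr H ^^ t) fps_X) (1 + t * i) =
           (\<Prod>r<t. of_nat (1 + r * i)) * fps_nth H (i + 1) ^ t"
    and "fps_nth ((incr H ^^ Suc t) fps_X) (2 + Suc t * i) =
           fps_nth ((incr H ^^ t) fps_X) (1 + t * i) * (of_nat (1 + t * i) * fps_nth H (i + 2) +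
             (if i = 1 then of_nat ((1 + t * i) choose 2) * fps_nth H 2 ^ 2 else 0))
           + of_nat (2 + t * i) * fps_nth ((incr H ^^ t) fps_X) (2 + t * i) * fps_nth H (i + 1)"
proof -
  have z: "\<forall>j < 1 + t * i. fps_nth ((incr H ^^ t) fps_X) j = 0" for t
  proof (induction t)
    case (Suc t)
    show ?case
      using compose_diff_coeffs(1)[OF H, of "1 + t * i" "(incr H ^^ t) fps_X"] Suc
      unfolding incr_pow_Suc by (simp add: algebra_simps)
  qed simp
  then show "j < 1 + t * i \<Longrightarrow> fps_nth ((incr H ^^ t) fps_X) j = 0"
    by blast
  show "fps_nth ((incr H ^^ t) fps_X) (1 + t * i) =
           (\<Prod>r<t. of_nat (1 + r * i)) * fps_nth H (i + 1) ^ t"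
  proof (induction t)
    case (Suc t)
    have "1 + Suc t * i = 1 + t * i + i" by simp
    then show ?case
      using compose_diff_coeffs(2)[OF H, of "1 + t * i" "(incr H ^^ t) fps_X"] z[of t] Suc
      unfolding incr_pow_Suc \<open>1 + Suc t * i = 1 + t * i + i\<close>
      by (simp add: mult_ac)
  qed simp
  have e: "2 + Suc t * i = 1 + t * i + i + 1" "2 + t * i = 1 + t * i + 1" by simp_all
  show "fps_nth ((incr H ^^ Suc t) fps_X) (2 + Suc t * i) =
           fps_nth ((incr H ^^ t) fps_X) (1 + t * i) * (of_nat (1 + t * i) * fps_nth H (i + 2) +
             (if i = 1 then of_nat ((1 + t * i) choose 2) * fps_nth H 2 ^ 2 else 0))
           + of_nat (2 + t * i) * fps_nth ((incr H ^^ t) fps_X) (2 + t * i) * fps_nth H (i + 1)"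
    using compose_diff_coeffs(3)[OF H, of "1 + t * i" "(incr H ^^ t) fps_X"] z[of t]
    unfolding e incr_pow_Suc by blast
qed

lemma iter_prime_coeff:
  fixes H :: "'a::field fps"
  assumes "fps_nth H 0 = 0" "prime p" "CHAR('a) = p"
  shows "fps_nth (fps_iter H p) j = (if j = 1 then 1 else 0) + fps_nth ((incr H ^^ p) fps_X) j"
proof -
  have "fps_iter H p = fps_X + (incr H ^^ p) fps_X"
    using compose_iter_prime[OF assms, of fps_X] assms(1) by (simp add: fps_iter_nth_0)
  then show ?thesis by (simp add: fps_X_def)
qed

lemma tangent_iter_prime:
  fixes H :: "'a::field fps"
  assumes H: "tangent i H" "i \<ge> 1" and p: "prime p" "CHAR('a) = p"
  shows "tangent (p * i) (fps_iter H p)"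
proof -
  have H0: "fps_nth H 0 = 0" using H by (simp add: tangent_def)
  have "p * i \<ge> 1" using H(2) prime_gt_0_nat[OF p(1)] by simp
  then show ?thesis
    unfolding tangent_def
    using incr_pow_X_coeffs(1)[OF H, of _ p] by (auto simp: iter_prime_coeff[OF H0 p])
qed

lemma iter_prime_lead:
  fixes H :: "'a::field fps"
  assumes H: "tangent i H" "i \<ge> 1" and p: "prime p" "CHAR('a) = p"
  shows "fps_nth (fps_iter H p) (p * i + 1) = (\<Prod>r<p. of_nat (1 + r * i)) * fps_nth H (i + 1) ^ p"
proof -
  have H0: "fps_nth H 0 = 0" using H by (simp add: tangent_def)
  have "p * i \<ge> 1" using H(2) prime_gt_0_nat[OF p(1)] by simp
  then show ?thesis
    using incr_pow_X_coeffs(2)[OF H, of p] H(2) p(1)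
    by (auto simp: iter_prime_coeff[OF H0 p] prime_gt_0_nat)
qed

lemma iter_prime_lead_dvd:
  fixes H :: "'a::field fps"
  assumes H: "tangent i H" "i \<ge> 1" and p: "prime p" "CHAR('a) = p" and i: "p dvd i"
  shows "fps_nth (fps_iter H p) (p * i + 1) = fps_nth H (i + 1) ^ p"
proof -
  have "of_nat i = (0::'a)" using i p(2) of_nat_eq_0_iff_char_dvd by blast
  then have "(\<Prod>r<p. of_nat (1 + r * i)) = (1::'a)" by simp
  then show ?thesis using iter_prime_lead[OF H p] by simp
qed

lemma of_nat_eq_mod_char:
  assumes "CHAR('a::comm_ring_1) = p" "m mod p = n mod p"
  shows "of_nat m = (of_nat n :: 'a)"
  using assms of_nat_eq_iff_cong_CHAR[of m n, where 'a = 'a] by (simp add: cong_def)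

lemma of_nat_eq_1_mod_char:
  assumes "CHAR('a::comm_ring_1) = p" "prime p" "m mod p = 1"
  shows "of_nat m = (1 :: 'a)"
proof -
  have "m mod p = 1 mod p"
    using mod_less[OF prime_gt_1_nat[OF assms(2)]] by (simp only: assms(3))
  then have "of_nat m = (of_nat 1 :: 'a)"
    by (rule of_nat_eq_mod_char[OF assms(1)])
  then show ?thesis by simp
qed

text \<open>If i = 1 in the field, the last of the degrees 1 + r i, at r = p - 1, is p = 0. This
  kills the leading coefficient of D^p z.\<close>

lemma tangent_iter_prime_cong1:
  fixes H :: "'a::field fps"
  assumes H: "tangent i H" "i \<ge> 1" and p: "prime p" "CHAR('a) = p" and i: "i mod p = 1"
  shows "tangent (p * i + 1) (fps_iter H p)"
proof -
  have i1: "of_nat i = (1::'a)"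
    using of_nat_eq_1_mod_char[OF p(2,1) i] .
  have "(\<Prod>r<p. of_nat (1 + r * i)) = (0::'a)"
  proof (rule prod_zero)
    show "\<exists>r\<in>{..<p}. of_nat (1 + r * i) = (0::'a)"
    proof (rule bexI[of _ "p - 1"])
      have "of_nat (1 + (p - 1) * i) = (of_nat p :: 'a)"
        using prime_gt_0_nat[OF p(1)] i1 by (cases p) auto
      also have "\<dots> = 0" using of_nat_CHAR[where 'a = 'a] by (simp add: p(2))
      finally show "of_nat (1 + (p - 1) * i) = (0::'a)" .
    qed (use p(1) in \<open>simp add: prime_gt_0_nat\<close>)
  qed simp
  then have "fps_nth (fps_iter H p) (p * i + 1) = 0"
    using iter_prime_lead[OF H p] by simp
  then show ?thesis
    using tangent_iter_prime[OF H p] unfolding tangent_def by (auto simp: le_Suc_eq)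
qed

text \<open>For i = 1 mod p, the first and second degrees met in the last two applications of D are
  -1 and 0 (after p - 2 applications), then 0 and 1. The first of these zeros erases the second
  coefficient accumulated so far, so only these two steps count, and \<open>fact (p - 2)\<close> is
  the product of the earlier leading degrees. When i = 1 the binomials involved are C(p - 1, 2) = 1
  and C(p, 2) = 0; the latter fails for p = 2.\<close>

lemma iter_prime_second:
  fixes H :: "'a::field fps"
  assumes H: "tangent i H" "i \<ge> 1" and p: "prime p" "CHAR('a) = p" and i: "i mod p = 1"
    and i2: "i = 1 \<longrightarrow> odd p"
  shows "fps_nth (fps_iter H p) (p * i + 2) =
           of_nat (fact (p - 2)) * fps_nth H (i + 1) ^ (p - 1) *
             ((if i = 1 then fps_nth H 2 ^ 2 else 0) - fps_nth H (i + 2))"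
proof -
  have H0: "fps_nth H 0 = 0" using H by (simp add: tangent_def)
  have p2: "p \<ge> 2" using p(1) by (rule prime_ge_2_nat)
  have p0: "of_nat p = (0::'a)" using of_nat_CHAR[where 'a = 'a] by (simp add: p(2))
  have i1: "of_nat i = (1::'a)"
    using of_nat_eq_1_mod_char[OF p(2,1) i] .
  obtain k where k: "p = Suc (Suc k)"
    using p2 that[of "p - 2"] by simp
  have "of_nat k + 2 = (of_nat (Suc (Suc k)) :: 'a)" by simp
  then have k0: "of_nat k = (- 2 :: 'a)"
    using p0 by (simp only: k eq_neg_iff_add_eq_0)
  have s1: "of_nat (1 + Suc k * i) = (0::'a)" "of_nat (2 + Suc k * i) = (1::'a)"
    "of_nat (1 + k * i) = (- 1::'a)" "of_nat (2 + k * i) = (0::'a)"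
    by (simp_all add: i1 k0)
  have xk: "fps_nth ((incr H ^^ k) fps_X) (1 + k * i) = of_nat (fact k) * fps_nth H (i + 1) ^ k"
    unfolding incr_pow_X_coeffs(2)[OF H]
    by (simp add: i1 fact_prod_Suc lessThan_atLeast0)
  have ch1: "of_nat (Suc (Suc k) choose 2) = (0::'a)" if "i = 1"
  proof -
    have "odd p" using that i2 by simp
    then have "2 < p"
      using p2 by (cases "p = 2") simp_all
    then have "p dvd (p choose 2)"
      by (intro prime_dvd_choose p(1)) simp_all
    then show ?thesis unfolding k[symmetric] of_nat_eq_0_iff_char_dvd p(2) .
  qed
  have ch2: "of_nat (Suc k choose 2) = (1::'a)" if "i = 1"
  proof -
    have "Suc (Suc k) choose 2 = Suc k + (Suc k choose 2)"
      by (simp add: numeral_2_eq_2)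
    then have "of_nat (Suc k) + of_nat (Suc k choose 2) = (0::'a)"
      using ch1[OF that] by (metis of_nat_add)
    then show ?thesis using k0 by simp
  qed
  have y1: "fps_nth ((incr H ^^ Suc k) fps_X) (2 + Suc k * i) = of_nat (fact k) * fps_nth H (i + 1) ^ k *
     ((if i = 1 then fps_nth H 2 ^ 2 else 0) - fps_nth H (i + 2))"
  proof -
    have "(if i = 1 then of_nat ((1 + k * i) choose 2) * fps_nth H 2 ^ 2 else 0) = (if i = 1 then fps_nth H 2 ^ 2 else 0)"
      using ch2 by simp
    then show ?thesis
      unfolding incr_pow_X_coeffs(3)[OF H, of k] xk s1 by simp
  qed
  have "(if i = 1 then of_nat ((1 + Suc k * i) choose 2) * fps_nth H 2 ^ 2 else 0) = 0"
    using ch1 by simp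
  then have "fps_nth ((incr H ^^ p) fps_X) (2 + p * i) =
     of_nat (fact k) * fps_nth H (i + 1) ^ k *
     ((if i = 1 then fps_nth H 2 ^ 2 else 0) - fps_nth H (i + 2)) * fps_nth H (i + 1)"
    unfolding k incr_pow_X_coeffs(3)[OF H, of "Suc k"] y1 s1 by simp
  moreover have "p * i + 2 \<noteq> 1" "p - 2 = k" "p - 1 = Suc k" "p * i + 2 = 2 + p * i"
    by (simp_all add: k)
  ultimately show ?thesis
    unfolding iter_prime_coeff[OF H0 p] by (simp add: mult_ac)
qed

text \<open>A relation instead of a function: it has no solution for the identity, whose
  ramification number is infinite, whereas \<open>ram_index\<close> still returns some number
  there.\<close>

definition ram_number :: "'a::comm_ring_1 fps \<Rightarrow> nat \<Rightarrow> bool" where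
  "ram_number H i \<longleftrightarrow> i \<ge> 1 \<and> tangent i H \<and> fps_nth H (i + 1) \<noteq> 0"

lemma ram_number_exists:
  assumes "fps_nth H 0 = 0" "fps_nth H 1 = 1" "H \<noteq> fps_X"
  shows "\<exists>i. ram_number H i"
proof -
  have "\<exists>j. j > 1 \<and> fps_nth H j \<noteq> 0"
  proof (rule ccontr)
    assume "\<not> ?thesis"
    then have "fps_nth H j = fps_nth fps_X j" for j
      using assms(1,2) by (cases "j = 0"; cases "j = 1") (auto simp: fps_X_def)
    then show False using assms(3) by (simp add: fps_eq_iff)
  qed
  define j where "j = (LEAST j. j > 1 \<and> fps_nth H j \<noteq> 0)"
  have j: "j > 1 \<and> fps_nth H j \<noteq> 0"
    unfolding j_def by (rule LeastI_ex) fact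
  have "fps_nth H l = 0" if "1 < l" "l < j" for l
    using not_less_Least[of l "\<lambda>j. j > 1 \<and> fps_nth H j \<noteq> 0"] that unfolding j_def by blast
  then have "ram_number H (j - 1)"
    using j assms unfolding ram_number_def tangent_def by auto
  then show ?thesis ..
qed

lemma ram_number_ge:
  assumes "ram_number H i" "tangent l H"
  shows "l \<le> i"
proof (rule ccontr)
  assume "\<not> l \<le> i"
  then have "fps_nth H (i + 1) = 0"
    using assms unfolding ram_number_def tangent_def by auto
  then show False using assms(1) by (simp add: ram_number_def)
qed

lemma ram_number_unique: "ram_number H i \<Longrightarrow> ram_number H l \<Longrightarrow> i = l"
  by (meson le_antisym ram_number_def ram_number_ge)

lemma ram_number_not_X: "ram_number H i \<Longrightarrow> H \<noteq> fps_X"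
  by (auto simp: ram_number_def fps_X_def)

text \<open>The minimal possible ramification numbers (1 + p + ... + p^m).\<close>
fun geo :: "nat \<Rightarrow> nat \<Rightarrow> nat" where
  "geo p 0 = 1"
| "geo p (Suc m) = p * geo p m + 1"

lemma geo_pos: "geo p m \<ge> 1"
  by (cases m) auto

lemma geo_mod: "p \<ge> 2 \<Longrightarrow> geo p m mod p = 1"
proof (cases m)
  case (Suc k)
  assume "p \<ge> 2"
  then have "1 mod p = 1" by simp
  then show ?thesis
    using mod_mult_self1[of 1 "geo p k" p] Suc by (simp add: mult.commute)
qed simp

lemma geo_mult:
  assumes "p \<ge> 1"
  shows "(p - 1) * geo p m + 1 = p ^ (m + 1)"
proof (induction m)
  case (Suc m)
  obtain k where k: "p = k + 1" using assms by (metis le_add_diff_inverse2)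
  have "(p - 1) * geo p (Suc m) + 1 = p * ((p - 1) * geo p m + 1)"
    unfolding k by (simp add: algebra_simps)
  then show ?case unfolding Suc.IH by simp
qed (use assms in simp)

lemma geo_closed: "p \<ge> 2 \<Longrightarrow> geo p m = (p ^ (m + 1) - 1) div (p - 1)"
  using geo_mult[of p m] by (metis add_diff_cancel_right' nonzero_mult_div_cancel_left
    One_nat_def Suc_1 diff_is_0_eq not_less_eq_eq le_trans one_le_numeral)

lemma geo_Suc_power: "geo p (Suc m) = geo p m + p ^ (m + 1)" 
  by (induction m) (auto simp: algebra_simps)

section \<open>Iterates of a series tangent to the identity in characteristic p\<close>

locale wild_iteration =
  fixes F :: "'a::field fps" and p :: nat
  assumes F0: "fps_nth F 0 = 0" and F1: "fps_nth F 1 = 1"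
    and prime_p: "prime p" and char_p: "CHAR('a) = p"
begin

definition G :: "nat \<Rightarrow> 'a fps" where "G n = fps_iter F (p ^ n)"

lemma p_ge_2: "p \<ge> 2"
  using prime_p by (rule prime_ge_2_nat)

lemma G_Suc: "G (Suc n) = fps_iter (G n) p"
  using fps_iter_mult[OF F0, of "p ^ n" p] by (simp add: G_def mult.commute)

lemma G_nth_0: "fps_nth (G n) 0 = 0"
  by (simp add: G_def fps_iter_nth_0 F0)

lemma G_commute: "G m oo G n = G n oo G m"
  unfolding G_def by (rule fps_iter_commute[OF F0])

lemma iter_nth_1: "fps_nth (fps_iter F m) 1 = 1"
  by (induction m) (simp_all add: fps_iter_Suc fps_compose_nth fps_iter_nth_0 F0 F1 F1[simplified])

lemma ram_number_step_ge:
  assumes "ram_number (G n) i" "ram_number (G (Suc n)) l"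
  shows "p * i \<le> l"
  using assms tangent_iter_prime[of i "G n", OF _ _ prime_p char_p] ram_number_ge[of "G (Suc n)" l]
  by (simp add: G_Suc ram_number_def)

lemma ram_number_below:
  assumes "ram_number (G n) i" "m \<le> n"
  shows "\<exists>l. ram_number (G m) l"
proof (rule ram_number_exists)
  show "G m \<noteq> fps_X"
  proof
    assume "G m = fps_X"
    then have "fps_iter (G m) l = fps_X" for l
      by (induction l) (simp_all add: fps_iter_Suc)
    then have "G n = fps_X"
      using fps_iter_mult[OF F0, of "p ^ m" "p ^ (n - m)"] assms(2) by (simp add: G_def flip: power_add)
    then show False using assms(1) ram_number_not_X by blast
  qed
qed (use G_nth_0 iter_nth_1 in \<open>auto simp: G_def\<close>)

text \<open>A weak form, modulo p only, of Sen's congruences: both leading coefficients in the first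
  commutation identity are nonzero and cancel.\<close>

lemma ram_number_cong:
  assumes "ram_number (G m) i" "ram_number (G n) l"
  shows "i mod p = l mod p"
proof -
  have "of_nat i = (of_nat l :: 'a)"
    using commuting_coeffs(1)[of i "G m" l "G n", OF _ _ _ _ G_commute] assms
    unfolding ram_number_def by simp
  then show ?thesis
    using of_nat_eq_iff_cong_CHAR[of i l, where 'a = 'a] char_p by (simp add: cong_def)
qed

lemma ram_number_step_ge_cong1:
  assumes "ram_number (G n) i" "ram_number (G (Suc n)) l" "i mod p = 1"
  shows "p * i + 1 \<le> l"
  using assms tangent_iter_prime_cong1[of i "G n", OF _ _ prime_p char_p] ram_number_ge[of "G (Suc n)" l]
  by (simp add: G_Suc ram_number_def)

text \<open>Since i_0 = 1, all ramification numbers are 1 mod p, so every step gains at least the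
  extra 1 in the recursion of \<open>geo\<close>.\<close>

lemma geo_le_ram_number:
  assumes "ram_number (G 0) 1" "ram_number (G n) i"
  shows "geo p n \<le> i"
  using assms(2)
proof (induction n arbitrary: i)
  case 0
  then show ?case using assms(1) ram_number_unique by fastforce
next
  case (Suc n)
  obtain l where l: "ram_number (G n) l"
    using ram_number_below[OF Suc.prems, of n] by auto
  have "l mod p = 1"
    using ram_number_cong[OF assms(1) l] p_ge_2 by simp
  then have "p * l + 1 \<le> i"
    using ram_number_step_ge_cong1[OF l Suc.prems] by simp
  moreover have "p * geo p n \<le> p * l"
    using Suc.IH[OF l] by (rule mult_le_mono2)
  ultimately show ?case unfolding geo.simps by linarith
qed

text \<open>The bounds leave no slack: an index l one level below satisfies p l <= p
  \<open>geo p n\<close> + 1 < p (\<open>geo p n\<close> + 1), so it is minimal as well.\<close>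

lemma ram_number_geo_below:
  assumes "ram_number (G 0) 1" "ram_number (G n) (geo p n)" "m \<le> n"
  shows "ram_number (G m) (geo p m)"
  using assms(2,3)
proof (induction n)
  case (Suc n)
  obtain l where l: "ram_number (G n) l"
    using ram_number_below[OF Suc.prems(1), of n] by auto
  have "p * l \<le> p * geo p n + 1"
    using ram_number_step_ge[OF l Suc.prems(1)] by simp
  have "l \<le> geo p n"
  proof (rule ccontr)
    assume "\<not> l \<le> geo p n"
    then have "p * (geo p n + 1) \<le> p * l" by (intro mult_le_mono2) simp
    then show False using \<open>p * l \<le> p * geo p n + 1\<close> p_ge_2 by simp
  qed
  then have "ram_number (G n) (geo p n)"
    using l geo_le_ram_number[OF assms(1) l] by simp
  then show ?case using Suc by (cases "m = Suc n") auto
qed simp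

text \<open>Let a, b and a', b' be the first two coefficients at levels n and n + 1, and c = a^2 if
  n = 0, c = 0 otherwise. With both indices equal to 1 in the field, the second commutation identity
  collapses to a b' = a' (b - c). As a' = (p - 2)! a^(p - 1) (c - b), a nonzero a' makes b'
  nonzero.\<close>

lemma second_coeff_propagates:
  assumes n: "ram_number (G n) (geo p n)" and S: "fps_nth (G (Suc n)) (p * geo p n + 2) \<noteq> 0"
    and b: "n = 0 \<longrightarrow> odd p"
  shows "ram_number (G (Suc n)) (geo p (Suc n))" 
    and "fps_nth (G (Suc n)) (geo p (Suc n) + 2) \<noteq> 0"
proof -
  let ?i = "geo p n" and ?l = "geo p (Suc n)"
  have i: "tangent ?i (G n)" "?i \<ge> 1" and a: "fps_nth (G n) (?i + 1) \<noteq> 0"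
    using n by (auto simp: ram_number_def)
  have m: "?i mod p = 1" using geo_mod[OF p_ge_2] .
  have i1: "?i = 1 \<longrightarrow> n = 0"
    using p_ge_2 geo_pos[of p] by (cases n) (auto simp: Suc_le_eq)
  have t: "tangent ?l (G (Suc n))"
    using tangent_iter_prime_cong1[OF i prime_p char_p m] by (simp add: G_Suc)
  show r: "ram_number (G (Suc n)) ?l"
    using t S by (simp add: ram_number_def)
  have l: "?l \<ge> 1" "?l \<noteq> 1" using p_ge_2 geo_pos[of p n] by auto
  have c1: "of_nat ?i = (1::'a)" "of_nat ?l = (1::'a)"
    using of_nat_eq_1_mod_char[OF char_p prime_p] geo_mod[OF p_ge_2] by blast+
  have ch: "of_nat ((?l + 1) choose 2) = (1::'a)" if "?i = 1"
  proof -
    have "odd p" using that i1 b by simp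
    have "2 * ((?l + 1) choose 2) = (?l + 1) * ?l"
      using times_binomial_minus1_eq[of 2 "?l + 1"] by simp
    then have "of_nat 2 * of_nat ((?l + 1) choose 2) = (of_nat (?l + 1) * of_nat ?l :: 'a)"
      by (metis of_nat_mult)
    moreover have "of_nat 2 \<noteq> (0::'a)"
      using \<open>odd p\<close> prime_p char_p p_ge_2 of_nat_eq_0_iff_char_dvd[of 2, where 'a = 'a]
      by (metis dvd_imp_le le_antisym zero_less_numeral even_numeral)
    ultimately show ?thesis using c1 by simp
  qed
  have S': "fps_nth (G (Suc n)) (?l + 1) = of_nat (fact (p - 2)) * fps_nth (G n) (?i + 1) ^ (p - 1) *
             ((if ?i = 1 then fps_nth (G n) 2 ^ 2 else 0) - fps_nth (G n) (?i + 2))"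
    using iter_prime_second[OF i prime_p char_p m] i1 b by (simp add: G_Suc)
  have nz: "(if ?i = 1 then fps_nth (G n) 2 ^ 2 else 0) - fps_nth (G n) (?i + 2) \<noteq> 0"
    using S S' by auto
  note c = commuting_coeffs(2)[OF i t l(1) G_commute]
  have "fps_nth (G n) (?i + 1) * fps_nth (G (Suc n)) (?l + 2) =
     fps_nth (G (Suc n)) (?l + 1) * (fps_nth (G n) (?i + 2) - (if ?i = 1 then fps_nth (G n) 2 ^ 2 else 0))"
  proof (cases "?i = 1")
    case True
    then show ?thesis
      using c l(2) c1 ch by (simp add: algebra_simps del: geo.simps)
  next
    case False
    then show ?thesis
      using c l(2) c1 by (simp add: algebra_simps del: geo.simps)
  qed
  moreover have "fps_nth (G (Suc n)) (?l + 1) \<noteq> 0" using r by (simp add: ram_number_def)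
  ultimately show "fps_nth (G (Suc n)) (?l + 2) \<noteq> 0"
    using nz a by auto
qed

lemma second_coeff_nonzero_step:
  assumes n: "ram_number (G n) (geo p n)" "n \<ge> 1" and b: "fps_nth (G n) (geo p n + 2) \<noteq> 0"
  shows "ram_number (G (Suc n)) (geo p (Suc n)) \<and> fps_nth (G (Suc n)) (geo p (Suc n) + 2) \<noteq> 0"
proof -
  let ?i = "geo p n"
  have i: "tangent ?i (G n)" "?i \<ge> 1" and a: "fps_nth (G n) (?i + 1) \<noteq> 0"
    using n by (auto simp: ram_number_def)
  have i1: "?i \<noteq> 1"
    using n(2) p_ge_2 geo_pos[of p "n - 1"] by (cases n) auto
  have "\<not> p dvd fact (p - 2)"
    using prime_dvd_fact_iff[OF prime_p, of "p - 2"] p_ge_2 by simp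
  then have "of_nat (fact (p - 2)) \<noteq> (0::'a)"
    using of_nat_eq_0_iff_char_dvd char_p by metis
  then have "fps_nth (G (Suc n)) (p * ?i + 2) \<noteq> 0"
    using iter_prime_second[OF i prime_p char_p geo_mod[OF p_ge_2]] i1 a b by (simp add: G_Suc)
  then show ?thesis
    using second_coeff_propagates[OF n(1)] n(2) by simp
qed

text \<open>Minimality at level n is the entry point: the leading coefficient there is nonzero,
  hence so is the second one, and the upward induction can start. The argument compares level n with
  level n - 1, which must not be level 0 when p = 2.\<close>

lemma ram_number_geo_all:
  assumes base: "ram_number (G 0) 1" and n: "ram_number (G n) (geo p n)" "n \<ge> 1"
    and n2: "even p \<longrightarrow> n \<ge> 2"
  shows "ram_number (G m) (geo p m)"
proof -
  obtain l where l: "Suc l = n" using n(2) by (cases n) auto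
  have "ram_number (G l) (geo p l)"
    using ram_number_geo_below[OF base n(1), of l] l by simp
  moreover have "fps_nth (G (Suc l)) (p * geo p l + 2) \<noteq> 0"
    using n(1) l by (auto simp: ram_number_def)
  ultimately have b: "fps_nth (G n) (geo p n + 2) \<noteq> 0"
    using second_coeff_propagates[of l] n2 l by auto
  have up: "ram_number (G (n + k)) (geo p (n + k)) \<and> fps_nth (G (n + k)) (geo p (n + k) + 2) \<noteq> 0" for k
  proof (induction k)
    case (Suc k)
    then show ?case using second_coeff_nonzero_step[of "n + k"] n(2) by simp
  qed (use n b in simp)
  show ?thesis
  proof (cases "m \<le> n")
    case True
    then show ?thesis using ram_number_geo_below[OF base n(1)] by simp
  next
    case False
    then show ?thesis using up[of "m - n"] by simp
  qed
qed

text \<open>An even i makes every degree 1 + r i equal to 1 in characteristic 2, so the leading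
  coefficient is squared and the index exactly doubles.\<close>

lemma ram_number_two_all:
  assumes "p = 2" "ram_number (G 0) 2"
  shows "ram_number (G m) (2 ^ (m + 1))"
proof (induction m)
  case (Suc m)
  have t: "tangent (2 ^ (m + 1)) (G m)" "2 ^ (m + 1) \<ge> (1::nat)" using Suc by (auto simp: ram_number_def)
  have "tangent (2 ^ (Suc m + 1)) (G (Suc m))"
    using tangent_iter_prime[OF t prime_p char_p] G_Suc[of m] by (simp add: assms(1))
  moreover have "fps_nth (G (Suc m)) (2 ^ (Suc m + 1) + 1) \<noteq> 0"
    using iter_prime_lead_dvd[OF t prime_p char_p] Suc assms(1) G_Suc[of m] by (simp add: ram_number_def)
  ultimately show ?case by (simp add: ram_number_def)
qed (use assms in simp)

text \<open>Write i for the index at level n - 1 and r for that at level 0. The gap and the bound p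
  i <= i + p^n give (p - 1) i <= p^n, while i >= p^(n - 1) r. So (p - 1) r <= p, that is, r = 1 or p
  = r = 2. If r = 1, the lower bound \<open>geo\<close> meets this upper bound; the one further
  value possible for p = 2 has the wrong parity.\<close>

theorem ram_number_gap_imp_minimal:
  assumes n: "n \<ge> 1" and i: "ram_number (G (n - 1)) i" and Si: "ram_number (G n) (i + p ^ n)"
    and n2: "p = 2 \<longrightarrow> n \<ge> 2"
  shows "(\<forall>m. ram_number (G m) (geo p m)) \<or> p = 2 \<and> (\<forall>m. ram_number (G m) (2 ^ (m + 1)))"
proof -
  obtain l where l: "n = Suc l" using n by (cases n) auto
  obtain r where r: "ram_number (G 0) r"
    using ram_number_below[OF i, of 0] by auto
  have "p * i \<le> i + p ^ n"
    using ram_number_step_ge[of l i] i Si l by simp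
  then have i_le: "(p - 1) * i \<le> p * p ^ l"
    by (simp add: l algebra_simps)
  have "p ^ k * r \<le> j" if "ram_number (G k) j" for k j
    using that
  proof (induction k arbitrary: j)
    case 0
    then show ?case using r ram_number_unique by fastforce
  next
    case (Suc k)
    obtain j' where j': "ram_number (G k) j'"
      using ram_number_below[OF Suc.prems, of k] by auto
    have "p ^ Suc k * r \<le> p * j'" using Suc.IH[OF j'] by (simp add: mult.assoc)
    also have "\<dots> \<le> j" using ram_number_step_ge[OF j' Suc.prems] .
    finally show ?case .
  qed
  then have "p ^ l * r \<le> i" using i l by simp
  then have "(p - 1) * (p ^ l * r) \<le> p * p ^ l"
    using i_le by (meson le_trans mult_le_mono2)
  then have "(p - 1) * r \<le> p"
    using p_ge_2 by (simp add: mult.left_commute)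
  moreover have "r \<ge> 1" using r by (simp add: ram_number_def)
  ultimately consider "r = 1" | "p = 2" "r = 2"
  proof -
    have "r = 1 \<or> p = 2 \<and> r = 2"
    proof (cases "r = 1")
      case False
      then have "r \<ge> 2" using \<open>r \<ge> 1\<close> by simp
      then have "(p - 1) * 2 \<le> p" using \<open>(p - 1) * r \<le> p\<close> by (meson le_trans mult_le_mono2)
      then have "p = 2" using p_ge_2 by simp
      then show ?thesis using \<open>(p - 1) * r \<le> p\<close> \<open>r \<ge> 2\<close> by simp
    qed simp
    then show ?thesis using that by blast
  qed
  then show ?thesis
  proof cases
    case 2
    then show ?thesis using ram_number_two_all r by blast
  next
    case 1
    then have base: "ram_number (G 0) 1" using r by simp
    have ge: "geo p l \<le> i" using geo_le_ram_number[OF base, of l i] i l by simp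
    have gm: "(p - 1) * geo p l + 1 = p * p ^ l" using geo_mult[of p l] p_ge_2 by simp
    have im: "i mod p = 1" using ram_number_cong[OF base i] p_ge_2 by simp
    have "i = geo p l"
    proof (rule ccontr)
      assume "i \<noteq> geo p l"
      then have "Suc (geo p l) \<le> i" using ge by simp
      then have "(p - 1) * Suc (geo p l) \<le> p * p ^ l" using i_le by (meson le_trans mult_le_mono2)
      then have "p - 1 \<le> 1" using gm by simp
      then have "p = 2" using p_ge_2 by simp
      then have "i \<le> Suc (geo p l)" using i_le gm by simp
      then have "i = Suc (geo p l)" using \<open>Suc (geo p l) \<le> i\<close> by simp
      then show False using im geo_mod[OF p_ge_2, of l] unfolding \<open>i = Suc _\<close> \<open>p = 2\<close> by presburger
    qed
    then have "ram_number (G n) (geo p n)"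
      using Si l geo_Suc_power[of p l] by simp
    moreover have "even p \<longrightarrow> n \<ge> 2"
      using n2 prime_p primes_dvd_imp_eq two_is_prime_nat by blast
    ultimately show ?thesis
      using ram_number_geo_all[OF base _ n] by blast
  qed
qed

end

section \<open>Passing to the quotient by the semisimple part\<close>

text \<open>Congruence modulo X^M, stable under products and under composition on either side. It
  replaces the limit that would define the exact semisimple part.\<close>

definition agree :: "nat \<Rightarrow> 'a::comm_ring_1 fps \<Rightarrow> 'a fps \<Rightarrow> bool" where
  "agree M u v \<longleftrightarrow> (\<forall>j<M. fps_nth u j = fps_nth v j)"

lemma agree_refl [simp]: "agree M u u"
  by (simp add: agree_def)

lemma agree_trans: "agree M u v \<Longrightarrow> agree M v w \<Longrightarrow> agree M u w"
  by (simp add: agree_def)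

lemma agree_mult: "agree M u v \<Longrightarrow> agree M w z \<Longrightarrow> agree M (u * w) (v * z)"
  by (auto simp: agree_def fps_mult_nth intro!: sum.cong)

lemma agree_power: "agree M u v \<Longrightarrow> agree M (u ^ n) (v ^ n)"
  by (induction n) (simp_all add: agree_mult)

lemma agree_compose_left: "agree M u v \<Longrightarrow> agree M (u oo c) (v oo c)"
  by (auto simp: agree_def fps_compose_nth intro!: sum.cong)

lemma agree_compose_right: "agree M u v \<Longrightarrow> agree M (f oo u) (f oo v)"
  using agree_power[of M u v] by (auto simp: agree_def fps_compose_nth intro!: sum.cong)

lemma agree_X_if_tangent:
  assumes "tangent i H"
  shows "agree (i + 1) H fps_X"
  unfolding agree_def
proof (intro allI impI)
  fix j assume "j < i + 1"
  then show "fps_nth H j = fps_nth fps_X j"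
    using assms by (cases "j = 0"; cases "j = 1") (auto simp: tangent_def fps_X_def)
qed

lemma has_order_dvd:
  assumes "has_order \<gamma> q" "\<gamma> ^ m = 1"
  shows "q dvd m"
proof -
  have q: "q > 0" "\<gamma> ^ q = 1" "\<And>j. 0 < j \<Longrightarrow> j < q \<Longrightarrow> \<gamma> ^ j \<noteq> 1"
    using assms(1) by (auto simp: has_order_def)
  have "\<gamma> ^ m = \<gamma> ^ (q * (m div q) + m mod q)" by simp
  also have "\<dots> = \<gamma> ^ (m mod q)" by (simp only: power_add power_mult q(2)) simp
  finally have "\<gamma> ^ (m mod q) = 1" using assms(2) by simp
  then have "m mod q = 0" using q(1) q(3)[of "m mod q"] by force
  then show ?thesis by blast
qed

lemma fps_iter_nth_1:
  fixes F :: "'a::idom fps"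
  assumes "fps_nth F 0 = 0"
  shows "fps_nth (fps_iter F m) 1 = fps_nth F 1 ^ m"
  by (induction m) (simp_all add: fps_iter_Suc fps_compose_nth fps_iter_nth_0 assms)

lemma power_coeffs_of_order:
  fixes \<tau> :: "'a::idom fps"
  assumes "\<And>j. j < q \<Longrightarrow> fps_nth \<tau> j = 0"
  shows "n < q * i \<Longrightarrow> fps_nth (\<tau> ^ i) n = 0" and "fps_nth (\<tau> ^ i) (q * i) = fps_nth \<tau> q ^ i"
proof -
  have "\<tau> = fps_X ^ q * fps_shift q \<tau>"
    using assms by (auto simp: fps_eq_iff fps_X_power_mult_nth)
  then have e: "\<tau> ^ i = fps_X ^ (q * i) * fps_shift q \<tau> ^ i"
    by (metis power_mult power_mult_distrib)
  show "n < q * i \<Longrightarrow> fps_nth (\<tau> ^ i) n = 0"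
    unfolding e by (simp add: fps_X_power_mult_nth)
  show "fps_nth (\<tau> ^ i) (q * i) = fps_nth \<tau> q ^ i"
    unfolding e by (simp add: fps_X_power_mult_nth fps_nth_power_0)
qed

lemma compose_coeffs_of_order:
  fixes \<tau> f :: "'a::idom fps"
  assumes \<tau>: "\<And>j. j < q \<Longrightarrow> fps_nth \<tau> j = 0" and f: "\<And>j. j < s \<Longrightarrow> fps_nth f j = 0" and q: "q \<ge> 1"
  shows "n < q * s \<Longrightarrow> fps_nth (f oo \<tau>) n = 0"
    and "fps_nth (f oo \<tau>) (q * s) = fps_nth f s * fps_nth \<tau> q ^ s"
proof -
  have z: "fps_nth f i * fps_nth (\<tau> ^ i) n = 0" if "i < s \<or> n < q * i" for i n
    using that f power_coeffs_of_order(1)[OF \<tau>] by auto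
  show "fps_nth (f oo \<tau>) n = 0" if n: "n < q * s"
    unfolding fps_compose_nth
  proof (intro sum.neutral ballI z)
    fix i
    show "i < s \<or> n < q * i"
      using n mult_le_mono2[of s i q] by linarith
  qed
  have "fps_nth (f oo \<tau>) (q * s) = (\<Sum>i\<in>{s}. fps_nth f i * fps_nth (\<tau> ^ i) (q * s))"
    unfolding fps_compose_nth
  proof (rule sum.mono_neutral_right)
    show "\<forall>i\<in>{0..q * s} - {s}. fps_nth f i * fps_nth (\<tau> ^ i) (q * s) = 0"
    proof (intro ballI z)
      fix i assume "i \<in> {0..q * s} - {s}"
      then show "i < s \<or> q * s < q * i" using q by auto
    qed
  qed (use q in auto)
  then show "fps_nth (f oo \<tau>) (q * s) = fps_nth f s * fps_nth \<tau> q ^ s"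
    using power_coeffs_of_order(2)[of q \<tau> s, OF \<tau>] by simp
qed

text \<open>Successive approximation. Let \<gamma> be the multiplier of \<open>s\<close>. The lowest
  coefficient r_m of the remainder satisfies r_m \<gamma>^m = r_m; unless it is 0, q divides m, and
  a multiple of the power of \<tau> with exponent m/q removes it.\<close>

lemma invariant_is_series_in_coordinate:
  fixes s \<tau> f :: "'a::field fps"
  assumes s: "fps_nth s 0 = 0" "has_order (fps_nth s 1) q"
    and \<tau>: "\<And>j. j < q \<Longrightarrow> fps_nth \<tau> j = 0" "fps_nth \<tau> q \<noteq> 0" "agree M (\<tau> oo s) \<tau>"
    and f: "agree M (f oo s) f"
  shows "\<exists>G. agree M f (G oo \<tau>)"
proof -
  have q: "q \<ge> 1" using s(2) by (simp add: has_order_def)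
  have \<tau>0: "fps_nth \<tau> 0 = 0" using \<tau>(1) q by simp
  have "m \<le> M \<Longrightarrow> \<exists>G. agree m f (G oo \<tau>)" for m
  proof (induction m)
    case 0
    then show ?case by (simp add: agree_def)
  next
    case (Suc m)
    then obtain G where G: "agree m f (G oo \<tau>)" by auto
    define r where "r = f - (G oo \<tau>)"
    have r0: "fps_nth r j = 0" if "j < m" for j
      using G that by (simp add: r_def agree_def)
    have "agree M ((G oo \<tau>) oo s) (G oo \<tau>)"
      using agree_compose_right[OF \<tau>(3), of G] by (simp add: fps_compose_assoc s \<tau>0)
    then have "agree M (r oo s) r"
      using f by (auto simp: r_def agree_def fps_compose_sub_distrib)
    then have "fps_nth (r oo s) m = fps_nth r m" using Suc.prems by (simp add: agree_def)
    moreover have "fps_nth (r oo s) (1 * m) = fps_nth r m * fps_nth s 1 ^ m"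
      by (rule compose_coeffs_of_order(2)) (use s r0 in auto)
    ultimately have rm: "fps_nth r m * fps_nth s 1 ^ m = fps_nth r m" by simp
    show ?case
    proof (cases "fps_nth r m = 0")
      case True
      then have "agree (Suc m) f (G oo \<tau>)"
        using G by (auto simp: agree_def r_def less_Suc_eq)
      then show ?thesis by blast
    next
      case False
      then obtain l where l: "m = q * l" using rm has_order_dvd[OF s(2), of m] by (auto elim: dvdE)
      define G' where "G' = G + fps_const (fps_nth r m / fps_nth \<tau> q ^ l) * fps_X ^ l"
      have G': "G' oo \<tau> = (G oo \<tau>) + fps_const (fps_nth r m / fps_nth \<tau> q ^ l) * \<tau> ^ l"
        using \<tau>0 by (simp add: G'_def fps_compose_add_distrib fps_compose_mult_distrib fps_X_power_compose)
      have "fps_nth f j = fps_nth (G' oo \<tau>) j" if "j < Suc m" for j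
      proof (cases "j = m")
        case True
        then show ?thesis
          using power_coeffs_of_order(2)[of q \<tau> l, OF \<tau>(1)] \<tau>(2) unfolding G'
          by (simp add: r_def l)
      next
        case False
        then have "j < m" using that by simp
        then show ?thesis
          using power_coeffs_of_order(1)[of q \<tau> j l, OF \<tau>(1)] r0[of j] unfolding G'
          by (simp add: r_def l)
      qed
      then show ?thesis by (auto simp: agree_def)
    qed
  qed
  then show ?thesis by blast
qed

lemma ex_power_cong_1:
  fixes p q :: nat
  assumes "coprime p q" "q \<ge> 1"
  shows "\<exists>t\<ge>1. [p ^ t = 1] (mod q)"
proof -
  have "card ((\<lambda>n. p ^ n mod q) ` {..q}) \<le> card {..<q}"
    using assms(2) by (intro card_mono) auto
  then have "\<not> inj_on (\<lambda>n. p ^ n mod q) {..q}"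
    by (intro pigeonhole) simp
  then obtain a b where ab: "a < b" "p ^ a mod q = p ^ b mod q"
    unfolding inj_on_def by (metis linorder_neqE_nat)
  have "[p ^ a * p ^ (b - a) = p ^ a * 1] (mod q)"
    using ab by (simp add: cong_def flip: power_add)
  then have "[p ^ (b - a) = 1] (mod q)"
    using assms(1) by (subst (asm) cong_mult_lcancel_nat) auto
  then show ?thesis using ab(1) by (intro exI[of _ "b - a"]) simp
qed

text \<open>A high p-power iterate s of g is, up to high order, the semisimple part of g: it has
  order q. Averaging over s linearizes it, and g then descends to the quotient coordinate.\<close>
lemma quotient_coordinate:
  fixes g :: "'a::field fps"
  assumes g: "fps_nth g 0 = 0" "has_order (fps_nth g 1) q"
    and p: "prime p" "CHAR('a) = p" "\<not> p dvd q"
  shows "\<exists>F \<tau>. fps_nth F 0 = 0 \<and> fps_nth F 1 = 1 \<and> (\<forall>j<q. fps_nth \<tau> j = 0) \<and> fps_nth \<tau> q \<noteq> 0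
     \<and> (\<forall>l. agree M (\<tau> oo fps_iter (fps_iter g q) l) (fps_iter F l oo \<tau>))"
proof -
  define \<gamma> where "\<gamma> = fps_nth g 1"
  define h where "h = fps_iter g q"
  have q: "q \<ge> 1" "\<gamma> ^ q = 1" using g(2) by (auto simp: has_order_def \<gamma>_def)
  have g0: "\<gamma> \<noteq> 0" using q by (metis not_one_le_zero power_0_left zero_neq_one)
  have h: "fps_nth h 0 = 0" "fps_nth h 1 = 1"
    using fps_iter_nth_0[OF g(1)] fps_iter_nth_1[OF g(1), of q] q by (simp_all add: h_def \<gamma>_def)
  \<comment> \<open>The extra room keeps the coefficients of degrees 0 and q in range; they
    determine \<open>F\<close> to first order even when M is small.\<close>
  define M' where "M' = M + q + 1"
  have "coprime p q" using p by (simp add: prime_imp_coprime)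
  then obtain t where t: "t \<ge> 1" "[p ^ t = 1] (mod q)"
    using ex_power_cong_1 q(1) by blast
  \<comment> \<open>A multiple of t gives \<gamma>^(p^N) = \<gamma>; being at least M' brings
    h^(p^N) to the identity modulo X^M'.\<close>
  define N where "N = t * M'"
  have pN: "[p ^ N = 1] (mod q)"
    unfolding N_def power_mult using cong_pow[OF t(2), of M'] by simp
  have \<gamma>N: "\<gamma> ^ (p ^ N) = \<gamma>"
  proof -
    have e: "\<gamma> ^ k = \<gamma> ^ (k mod q)" for k
    proof -
      have "\<gamma> ^ k = \<gamma> ^ (q * (k div q) + k mod q)" by simp
      then show ?thesis by (simp only: power_add power_mult q(2)) simp
    qed
    show ?thesis using e[of "p ^ N"] e[of 1] pN by (simp add: cong_def)
  qed
  have "tangent (p ^ n) (fps_iter h (p ^ n))" for n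
  proof (induction n)
    case 0
    then show ?case using h by (auto simp: tangent_def fps_iter_1)
  next
    case (Suc n)
    have "fps_iter h (p ^ Suc n) = fps_iter (fps_iter h (p ^ n)) p"
      using fps_iter_mult[OF h(1), of "p ^ n" p] by (simp add: mult.commute)
    then show ?case using tangent_iter_prime[OF Suc _ p(1,2)] prime_gt_0_nat[OF p(1)] by simp
  qed
  then have "agree (p ^ N + 1) (fps_iter h (p ^ N)) fps_X"
    using agree_X_if_tangent by blast
  moreover have "M' \<le> p ^ N + 1"
  proof -
    have "M' \<le> N" using mult_le_mono1[OF t(1), of M'] by (simp add: N_def)
    also have "N < p ^ N" using prime_gt_1_nat[OF p(1)] power_gt_expt[of p N] by simp
    finally show ?thesis by simp
  qed
  ultimately have hN: "agree M' (fps_iter h (p ^ N)) fps_X" by (auto simp: agree_def)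
  define s where "s = fps_iter g (p ^ N)"
  have s: "fps_nth s 0 = 0" "fps_nth s 1 = \<gamma>"
    using fps_iter_nth_0[OF g(1)] fps_iter_nth_1[OF g(1), of "p ^ N"] \<gamma>N by (simp_all add: s_def \<gamma>_def)
  have sq: "fps_iter s q = fps_iter h (p ^ N)"
    unfolding s_def h_def using fps_iter_mult[OF g(1)] by (metis mult.commute)
  \<comment> \<open>The averaging operator without its factor 1/q. Composition with \<open>s\<close>
    multiplies \<phi> by \<gamma> up to the defect s^q - X, and the linear coefficient is q, nonzero
    because p does not divide q. The q-th power of \<phi> is then invariant.\<close>
  define \<phi> where "\<phi> = (\<Sum>j<q. fps_const (inverse \<gamma> ^ j) * fps_iter s j)"
  have \<phi>0: "fps_nth \<phi> 0 = 0" by (simp add: \<phi>_def fps_sum_nth fps_iter_nth_0 s)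
  have "fps_nth \<phi> 1 = (\<Sum>j<q. inverse \<gamma> ^ j * \<gamma> ^ j)"
    using fps_iter_nth_1[OF s(1)] s(2) by (simp add: \<phi>_def fps_sum_nth)
  also have "\<dots> = of_nat q" using g0 by (simp flip: power_mult_distrib)
  finally have \<phi>1: "fps_nth \<phi> 1 \<noteq> 0" using p of_nat_eq_0_iff_char_dvd[of q, where 'a = 'a] by simp
  have "\<phi> oo s = (\<Sum>j<q. fps_const (inverse \<gamma> ^ j) * fps_iter s (Suc j))"
    using fps_iter_add[OF s(1), of _ 1] s(1)
    by (simp add: \<phi>_def fps_compose_sum_distrib fps_compose_mult_distrib fps_iter_1)
  also have "\<dots> = fps_const \<gamma> * (\<Sum>j<q. fps_const (inverse \<gamma> ^ Suc j) * fps_iter s (Suc j))"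
    using g0 by (simp add: sum_distrib_left mult.assoc[symmetric])
  also have "(\<Sum>j<q. fps_const (inverse \<gamma> ^ Suc j) * fps_iter s (Suc j)) = \<phi> - fps_X + fps_iter s q"
  proof -
    have "(\<Sum>j<Suc q. fps_const (inverse \<gamma> ^ j) * fps_iter s j) = \<phi> + fps_iter s q"
      using q(2) by (simp add: \<phi>_def power_inverse)
    moreover have "(\<Sum>j<Suc q. fps_const (inverse \<gamma> ^ j) * fps_iter s j) =
        fps_X + (\<Sum>j<q. fps_const (inverse \<gamma> ^ Suc j) * fps_iter s (Suc j))"
      by (subst sum.lessThan_Suc_shift) simp
    ultimately show ?thesis by (simp add: algebra_simps)
  qed
  finally have "\<phi> oo s = fps_const \<gamma> * (\<phi> - fps_X + fps_iter s q)" .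
  moreover have "agree M' (\<phi> - fps_X + fps_iter s q) \<phi>"
    using hN unfolding sq agree_def by simp
  ultimately have \<phi>s: "agree M' (\<phi> oo s) (fps_const \<gamma> * \<phi>)"
    using agree_mult[OF agree_refl] by metis
  define \<tau> where "\<tau> = \<phi> ^ q"
  have \<tau>: "\<And>j. j < q \<Longrightarrow> fps_nth \<tau> j = 0" "fps_nth \<tau> q \<noteq> 0"
    using power_coeffs_of_order(1)[of 1 \<phi> _ q] power_coeffs_of_order(2)[of 1 \<phi> q] \<phi>0 \<phi>1
    by (auto simp: \<tau>_def)
  have \<tau>0: "fps_nth \<tau> 0 = 0" using \<tau>(1) q by simp
  have "agree M' ((\<phi> oo s) ^ q) ((fps_const \<gamma> * \<phi>) ^ q)"
    using \<phi>s by (rule agree_power)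
  then have \<tau>s: "agree M' (\<tau> oo s) \<tau>"
    using s(1) q(2) by (simp add: \<tau>_def fps_compose_power power_mult_distrib fps_const_power)
  have hs: "h oo s = s oo h" unfolding h_def s_def by (rule fps_iter_commute[OF g(1)])
  have "(\<tau> oo h) oo s = (\<tau> oo s) oo h"
    using fps_compose_assoc[OF s(1) h(1), of \<tau>] fps_compose_assoc[OF h(1) s(1), of \<tau>] hs by simp
  then have "agree M' ((\<tau> oo h) oo s) (\<tau> oo h)"
    using agree_compose_left[OF \<tau>s] by simp
  then obtain F where F: "agree M' (\<tau> oo h) (F oo \<tau>)"
    using invariant_is_series_in_coordinate[OF s(1) _ \<tau> \<tau>s] g(2) s(2) by (auto simp: \<gamma>_def)
  have F0: "fps_nth F 0 = 0"
    using F \<tau>0 by (auto simp: agree_def M'_def dest!: spec[of _ 0])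
  have "fps_nth (\<tau> oo h) q = fps_nth (F oo \<tau>) q"
    using F by (simp add: agree_def M'_def)
  moreover have "fps_nth (F oo \<tau>) (q * 1) = fps_nth F 1 * fps_nth \<tau> q ^ 1"
    by (rule compose_coeffs_of_order(2)) (use \<tau>(1) q F0 in auto)
  moreover have "fps_nth (\<tau> oo h) (1 * q) = fps_nth \<tau> q * fps_nth h 1 ^ q"
    by (rule compose_coeffs_of_order(2)) (use \<tau>(1) q h in auto)
  ultimately have F1: "fps_nth F 1 = 1" using \<tau>(2) h(2) by simp
  have "agree M' (\<tau> oo fps_iter h l) (fps_iter F l oo \<tau>)" for l
  proof (induction l)
    case 0
    then show ?case using \<tau>0 by simp
  next
    case (Suc l)
    have "\<tau> oo fps_iter h (Suc l) = (\<tau> oo h) oo fps_iter h l"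
      using h(1) by (simp add: fps_iter_Suc fps_compose_assoc fps_iter_nth_0)
    also have "agree M' \<dots> ((F oo \<tau>) oo fps_iter h l)"
      using F by (rule agree_compose_left)
    also have "(F oo \<tau>) oo fps_iter h l = F oo (\<tau> oo fps_iter h l)"
      using h(1) \<tau>0 by (simp add: fps_compose_assoc fps_iter_nth_0)
    finally have "agree M' (\<tau> oo fps_iter h (Suc l)) (F oo (\<tau> oo fps_iter h l))" .
    moreover have "agree M' (F oo (\<tau> oo fps_iter h l)) (F oo (fps_iter F l oo \<tau>))"
      using Suc by (rule agree_compose_right)
    moreover have "F oo (fps_iter F l oo \<tau>) = fps_iter F (Suc l) oo \<tau>"
      using F0 \<tau>0 by (simp add: fps_iter_Suc fps_compose_assoc fps_iter_nth_0)
    ultimately show ?case using agree_trans by metis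
  qed
  then have "\<forall>l. agree M (\<tau> oo fps_iter (fps_iter g q) l) (fps_iter F l oo \<tau>)"
    by (auto simp: agree_def M'_def h_def)
  then show ?thesis using F0 F1 \<tau> by blast
qed

text \<open>Two computations of one order: \<tau> o H - \<tau> starts in degree q + i because q is
  nonzero in the field, and (K - X) o \<tau> starts in degree q + q j. The series agree below M, so
  i = q j as soon as one of these degrees is below M.\<close>

lemma ram_number_quotient:
  fixes H K \<tau> :: "'a::field fps"
  assumes \<tau>: "\<And>j. j < q \<Longrightarrow> fps_nth \<tau> j = 0" "fps_nth \<tau> q \<noteq> 0" and q: "q \<ge> 1" "of_nat q \<noteq> (0::'a)"
    and ag: "agree M (\<tau> oo H) (K oo \<tau>)"
    and H: "fps_nth H 0 = 0" "fps_nth H 1 = 1" and K: "fps_nth K 0 = 0" "fps_nth K 1 = 1"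
  shows "ram_number H i \<Longrightarrow> q + i < M \<Longrightarrow> \<exists>j. i = q * j \<and> ram_number K j"
    and "ram_number K j \<Longrightarrow> q + q * j < M \<Longrightarrow> ram_number H (q * j)"
proof -
  have \<tau>0: "fps_nth \<tau> 0 = 0" using \<tau>(1) q by simp
  have ag': "fps_nth ((\<tau> oo H) - \<tau>) n = fps_nth ((K - fps_X) oo \<tau>) n" if "n < M" for n
    using ag that \<tau>0 by (simp add: agree_def fps_compose_sub_distrib)
  have h: "fps_nth ((\<tau> oo H) - \<tau>) n = 0" "fps_nth ((\<tau> oo H) - \<tau>) (q + i) \<noteq> 0" 
    if "ram_number H i" "n < q + i" for n i
    using compose_diff_coeffs(1,2)[of i H q \<tau>, OF _ _ \<tau>(1)] that \<tau>(2) q by (auto simp: ram_number_def)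
  have k: "fps_nth ((K - fps_X) oo \<tau>) n = 0" "fps_nth ((K - fps_X) oo \<tau>) (q + q * j) \<noteq> 0"
    if j: "ram_number K j" "n < q + q * j" for n j
  proof -
    have z: "fps_nth (K - fps_X) l = 0" if "l < j + 1" for l
      using j that K by (cases "l = 0"; cases "l = 1") (auto simp: ram_number_def tangent_def fps_X_def)
    show "fps_nth ((K - fps_X) oo \<tau>) n = 0"
      by (rule compose_coeffs_of_order(1)[of q \<tau> "j + 1"]) (use \<tau> z j q in auto)
    have "fps_nth ((K - fps_X) oo \<tau>) (q * (j + 1)) = fps_nth (K - fps_X) (j + 1) * fps_nth \<tau> q ^ (j + 1)"
      by (rule compose_coeffs_of_order(2)) (use \<tau> z q in auto)
    then show "fps_nth ((K - fps_X) oo \<tau>) (q + q * j) \<noteq> 0"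
      using j(1) \<tau>(2) by (auto simp: ram_number_def fps_X_def)
  qed
  have cmp: "i = q * j" if i: "ram_number H i" and j: "ram_number K j" and lt: "q + i < M \<or> q + q * j < M" for i j
  proof (rule linorder_cases[of i "q * j"])
    assume "i < q * j"
    then show ?thesis using h(2)[OF i, of 0] k(1)[OF j, of "q + i"] ag'[of "q + i"] lt q by auto
  next
    assume "q * j < i"
    then show ?thesis using h(1)[OF i, of "q + q * j"] k(2)[OF j, of 0] ag'[of "q + q * j"] lt q by auto
  qed
  show "\<exists>j. i = q * j \<and> ram_number K j" if i: "ram_number H i" "q + i < M"
  proof -
    have "K \<noteq> fps_X" using h(2)[OF i(1), of 0] ag'[OF i(2)] q by auto
    then show ?thesis using ram_number_exists[OF K] cmp i by metis
  qed
  show "ram_number H (q * j)" if j: "ram_number K j" "q + q * j < M"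
  proof -
    have "H \<noteq> fps_X" using k(2)[OF j(1), of 0] ag'[OF j(2)] q by auto
    then show ?thesis using ram_number_exists[OF H] cmp j by metis
  qed
qed

theorem ram_number_gap_imp_minimal_general:
  fixes g :: "'a::field fps"
  assumes g: "fps_nth g 0 = 0" "has_order (fps_nth g 1) q"
    and p: "prime p" "CHAR('a) = p" "\<not> p dvd q"
    and n: "n \<ge> 1" "p = 2 \<longrightarrow> n \<ge> 2"
    and i: "ram_number (fps_iter g (q * p ^ (n - 1))) i"
    and Si: "ram_number (fps_iter g (q * p ^ n)) (i + q * p ^ n)"
  shows "(\<forall>m. ram_number (fps_iter g (q * p ^ m)) (q * geo p m)) \<or>
    p = 2 \<and> (\<forall>m. ram_number (fps_iter g (q * p ^ m)) (q * 2 ^ (m + 1)))"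
proof -
  define h where "h = fps_iter g q"
  have H: "fps_iter g (q * l) = fps_iter h l" for l
    unfolding h_def by (rule fps_iter_mult[OF g(1)])
  have q: "q \<ge> 1" "fps_nth g 1 ^ q = 1" using g(2) by (auto simp: has_order_def)
  have h: "fps_nth h 0 = 0" "fps_nth h 1 = 1"
    using fps_iter_nth_0[OF g(1)] fps_iter_nth_1[OF g(1), of q] q by (simp_all add: h_def)
  have q0: "of_nat q \<noteq> (0::'a)" using p of_nat_eq_0_iff_char_dvd[of q, where 'a = 'a] by simp
  define R where "R m i = ram_number (fps_iter h (p ^ m)) i" for m i
  \<comment> \<open>The truncation order, hence the quotient series, depends on m, so the
    alternative might vary with m. Recording the value at level 0, q or 2q, ties all m to the same
    case.\<close>
  have one: "R 0 q \<and> R m (q * geo p m) \<or> p = 2 \<and> R 0 (q * 2) \<and> R m (q * 2 ^ (m + 1))" for m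
  proof -
    define M where "M = q + i + q * p ^ n + q * geo p m + q * 2 ^ (m + 1) + 2 * q + 1"
    obtain F \<tau> where F: "fps_nth F 0 = 0" "fps_nth F 1 = 1"
      and \<tau>: "\<And>j. j < q \<Longrightarrow> fps_nth \<tau> j = 0" "fps_nth \<tau> q \<noteq> 0"
      and ag: "\<And>l. agree M (\<tau> oo fps_iter h l) (fps_iter F l oo \<tau>)"
      using quotient_coordinate[OF g p, of M] unfolding h_def by blast
    interpret wild_iteration F p
      by unfold_locales (use F p in auto)
    have k1: "fps_nth (fps_iter h l) 1 = 1" "fps_nth (fps_iter F l) 1 = 1" for l
      using fps_iter_nth_1[OF h(1), of l] fps_iter_nth_1[OF F(1), of l] h F by simp_all
    note tr = ram_number_quotient[OF \<tau> q(1) q0 ag fps_iter_nth_0[OF h(1)] k1(1) fps_iter_nth_0[OF F(1)] k1(2)]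
    have R: "R l (q * j)" if "ram_number (G l) j" "q + q * j < M" for l j
      using tr(2)[of "p ^ l" j] that by (simp add: R_def G_def)
    obtain j where j: "i = q * j" "ram_number (G (n - 1)) j"
      using tr(1)[of "p ^ (n - 1)" i] i by (auto simp: H G_def M_def)
    obtain j' where j': "i + q * p ^ n = q * j'" "ram_number (G n) j'"
      using tr(1)[of "p ^ n" "i + q * p ^ n"] Si by (auto simp: H G_def M_def)
    have "q * j' = q * (j + p ^ n)" using j j' by (simp add: algebra_simps)
    then have "j' = j + p ^ n" using q by simp
    then have "(\<forall>m. ram_number (G m) (geo p m)) \<or> p = 2 \<and> (\<forall>m. ram_number (G m) (2 ^ (m + 1)))"
      using ram_number_gap_imp_minimal[OF n(1) j(2) _ n(2)] j'(2) by simp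
    then show ?thesis
    proof
      assume a: "\<forall>m. ram_number (G m) (geo p m)"
      have "R 0 (q * 1)" using R[of 0 1] a[rule_format, of 0] by (simp add: M_def)
      moreover have "R m (q * geo p m)" using R[of m "geo p m"] a[rule_format, of m] by (simp add: M_def)
      ultimately show ?thesis by simp
    next
      assume a: "p = 2 \<and> (\<forall>m. ram_number (G m) (2 ^ (m + 1)))"
      have "R 0 (q * 2)" using R[of 0 2] conjunct2[OF a, rule_format, of 0] by (simp add: M_def)
      moreover have "R m (q * 2 ^ (m + 1))"
        using R[of m "2 ^ (m + 1)"] conjunct2[OF a, rule_format, of m] by (simp add: M_def)
      ultimately show ?thesis using a by simp
    qed
  qed
  show ?thesis
  proof (cases "R 0 q")
    case True
    then have "\<not> R 0 (q * 2)" using ram_number_unique[of _ q "q * 2"] q(1) by (auto simp: R_def)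
    then show ?thesis using one by (simp add: H R_def)
  next
    case False
    then have "p = 2 \<and> (\<forall>m. R m (q * 2 ^ (m + 1)))" using one by blast
    then show ?thesis unfolding R_def H by blast
  qed
qed

section \<open>Polynomials over the valuation ring\<close>

locale ultrametric_residue =
  fixes v :: "'a::field \<Rightarrow> real" and red :: "'a \<Rightarrow> 'k::field"
  assumes ultra: "ultrametric_abs v" and residue: "residue_map v red"
begin

lemma v_nonneg [simp]: "v x \<ge> 0" and v_eq_0 [simp]: "v x = 0 \<longleftrightarrow> x = 0"
  and v_mult: "v (x * y) = v x * v y" and v_add: "v (x + y) \<le> max (v x) (v y)"
  using ultra by (auto simp: ultrametric_abs_def)

lemma v_0 [simp]: "v 0 = 0"
  by simp

lemma v_1 [simp]: "v 1 = 1"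
  using v_mult[of 1 1] v_eq_0[of 1] by (simp del: v_eq_0)

lemma v_uminus [simp]: "v (- x) = v x"
proof -
  have "v (- 1) * v (- 1) = 1" using v_mult[of "- 1" "- 1"] by simp
  then have "v (- 1) = 1" using v_nonneg[of "- 1"] by (metis abs_of_nonneg abs_square_eq_1 power2_eq_square)
  then show ?thesis using v_mult[of "- 1" x] by simp
qed

lemma v_diff: "v (x - y) \<le> max (v x) (v y)"
  using v_add[of x "- y"] by simp

lemma v_power: "v (x ^ n) = v x ^ n"
  by (induction n) (simp_all add: v_mult)

lemma v_divide: "v (x / y) = v x / v y"
proof (cases "y = 0")
  case False
  then have "v (x / y) * v y = v x" using v_mult[of "x / y" y] by simp
  then show ?thesis using False by (simp add: field_simps)
qed simp

lemma v_add_eq: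
  assumes "v x < v y"
  shows "v (x + y) = v y"
proof (rule antisym)
  show "v (x + y) \<le> v y" using v_add[of x y] assms by simp
  show "v y \<le> v (x + y)" using v_diff[of "x + y" x] assms by (simp add: max_def split: if_splits)
qed

lemma v_prod: "v (prod f S) = (\<Prod>x\<in>S. v (f x))"
  by (induction S rule: infinite_finite_induct) (simp_all add: v_mult)

lemma v_sum_le_1: "(\<And>i. i \<in> S \<Longrightarrow> v (f i) \<le> 1) \<Longrightarrow> v (sum f S) \<le> 1"
proof (induction S rule: infinite_finite_induct)
  case (insert x S)
  then show ?case using v_add[of "f x" "sum f S"] by fastforce
qed simp_all

lemma v_mult_le_1: "v x \<le> 1 \<Longrightarrow> v y \<le> 1 \<Longrightarrow> v (x * y) \<le> 1"
  using mult_mono[of "v x" 1 "v y" 1] by (simp add: v_mult)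

lemma red_1 [simp]: "red 1 = 1" and red_add: "v x \<le> 1 \<Longrightarrow> v y \<le> 1 \<Longrightarrow> red (x + y) = red x + red y"
  and red_mult: "v x \<le> 1 \<Longrightarrow> v y \<le> 1 \<Longrightarrow> red (x * y) = red x * red y"
  and red_eq_0: "v x \<le> 1 \<Longrightarrow> red x = 0 \<longleftrightarrow> v x < 1"
  using residue by (auto simp: residue_map_def)

lemma red_0 [simp]: "red 0 = 0"
  using red_eq_0[of 0] by simp

lemma red_uminus: "v x \<le> 1 \<Longrightarrow> red (- x) = - red x"
  using red_add[of x "- x"] by (simp add: eq_neg_iff_add_eq_0 add.commute)

lemma red_power: "v x \<le> 1 \<Longrightarrow> red (x ^ n) = red x ^ n"
  by (induction n) (simp_all add: red_mult v_power power_le_one)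

lemma red_sum: "(\<And>i. i \<in> S \<Longrightarrow> v (f i) \<le> 1) \<Longrightarrow> red (sum f S) = (\<Sum>i\<in>S. red (f i))"
proof (induction S rule: infinite_finite_induct)
  case (insert x S)
  then show ?case using v_sum_le_1[of S f] by (simp add: red_add)
qed simp_all

definition integral_poly :: "'a poly \<Rightarrow> bool" where
  "integral_poly p \<longleftrightarrow> (\<forall>i. v (coeff p i) \<le> 1)"

abbreviation red_poly :: "'a poly \<Rightarrow> 'k poly" where
  "red_poly \<equiv> map_poly red"

lemma coeff_red_poly [simp]: "coeff (red_poly p) i = red (coeff p i)"
  by (simp add: coeff_map_poly)

lemma integral_poly_pCons: "integral_poly (pCons a p) \<longleftrightarrow> v a \<le> 1 \<and> integral_poly p"
proof
  assume a: "integral_poly (pCons a p)"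
  have "v (coeff (pCons a p) (Suc i)) \<le> 1" "v (coeff (pCons a p) 0) \<le> 1" for i
    using a unfolding integral_poly_def by blast+
  then show "v a \<le> 1 \<and> integral_poly p" by (simp add: integral_poly_def)
qed (auto simp: integral_poly_def coeff_pCons split: nat.splits)

lemma integral_poly_0 [simp]: "integral_poly 0" and integral_poly_1 [simp]: "integral_poly 1"
  and integral_poly_X [simp]: "integral_poly [:0, 1:]"
  by (simp_all add: integral_poly_pCons one_pCons) (simp_all add: integral_poly_def)

lemma integral_poly_add: "integral_poly p \<Longrightarrow> integral_poly r \<Longrightarrow> integral_poly (p + r)"
  unfolding integral_poly_def using v_add by (metis coeff_add max.bounded_iff order_trans max_def)

lemma integral_poly_diff: "integral_poly p \<Longrightarrow> integral_poly r \<Longrightarrow> integral_poly (p - r)"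
  unfolding integral_poly_def using v_diff by (metis coeff_diff max.bounded_iff order_trans max_def)

lemma integral_poly_mult: "integral_poly p \<Longrightarrow> integral_poly r \<Longrightarrow> integral_poly (p * r)"
  unfolding integral_poly_def coeff_mult by (auto intro!: v_sum_le_1 v_mult_le_1)

lemma integral_poly_pcompose: "integral_poly p \<Longrightarrow> integral_poly r \<Longrightarrow> integral_poly (pcompose p r)"
  by (induction p) (auto simp: pcompose_pCons integral_poly_pCons intro!: integral_poly_add integral_poly_mult)

lemma red_poly_pCons: "red_poly (pCons a p) = pCons (red a) (red_poly p)"
  by (simp add: poly_eq_iff coeff_pCons split: nat.splits)

lemma red_poly_1 [simp]: "red_poly 1 = 1" and red_poly_X [simp]: "red_poly [:0, 1:] = [:0, 1:]"
  by (simp_all add: one_pCons red_poly_pCons)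

lemma red_poly_add: "integral_poly p \<Longrightarrow> integral_poly r \<Longrightarrow> red_poly (p + r) = red_poly p + red_poly r"
  by (simp add: poly_eq_iff integral_poly_def red_add)

lemma red_poly_diff: "integral_poly p \<Longrightarrow> integral_poly r \<Longrightarrow> red_poly (p - r) = red_poly p - red_poly r"
  using red_poly_add[of "p - r" r] by (simp add: integral_poly_diff algebra_simps)

lemma red_poly_mult: "integral_poly p \<Longrightarrow> integral_poly r \<Longrightarrow> red_poly (p * r) = red_poly p * red_poly r"
  by (auto simp: poly_eq_iff integral_poly_def coeff_mult red_sum v_mult_le_1 red_mult intro!: sum.cong)

lemma red_poly_smult: "v c \<le> 1 \<Longrightarrow> integral_poly p \<Longrightarrow> red_poly (Polynomial.smult c p) = Polynomial.smult (red c) (red_poly p)"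
  by (simp add: poly_eq_iff integral_poly_def red_mult)

lemma red_poly_pcompose:
  assumes "integral_poly p" "integral_poly r"
  shows "red_poly (pcompose p r) = pcompose (red_poly p) (red_poly r)"
  using assms
proof (induction p)
  case (pCons a p)
  then show ?case
    by (simp add: pcompose_pCons red_poly_pCons red_poly_add red_poly_mult integral_poly_pCons
        integral_poly_mult integral_poly_pcompose)
qed simp

lemma v_poly_le_1: "integral_poly p \<Longrightarrow> v z \<le> 1 \<Longrightarrow> v (poly p z) \<le> 1"
proof (induction p)
  case (pCons a p)
  then have "v a \<le> 1" "v (z * poly p z) \<le> 1"
    by (simp_all add: integral_poly_pCons v_mult_le_1)
  then show ?case
    using order_trans[OF v_add[of a "z * poly p z"], of 1] by simp
qed simp

text \<open>In the open disk a unit constant term dominates. This yields the absence of roots of the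
  cofactor in Weierstrass preparation, the invariance of |z| under P, and the divisibility of
  periods by q.\<close>

lemma v_poly_eq_1:
  assumes "integral_poly p" "v (coeff p 0) = 1" "v z < 1"
  shows "v (poly p z) = 1"
proof -
  obtain a r where p: "p = pCons a r" by (cases p)
  have "v (poly r z) \<le> 1" using assms v_poly_le_1[of r z] by (simp add: p integral_poly_pCons)
  then have "v z * v (poly r z) \<le> v z * 1" by (intro mult_left_mono) simp_all
  then have "v (z * poly r z) < v a" using assms by (simp add: p v_mult)
  then show ?thesis using v_add_eq[of "z * poly r z" a] assms by (simp add: p add.commute)
qed

end

section \<open>Iterates of polynomials and their ramification numbers\<close>

lemma poly_iter_0 [simp]: "poly_iter h 0 = [:0, 1:]"
  and poly_iter_Suc: "poly_iter h (Suc m) = pcompose h (poly_iter h m)"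
  by (simp_all add: poly_iter_def)

lemma poly_iter_1 [simp]: "poly_iter h (Suc 0) = h"
  by (simp add: poly_iter_Suc)

lemma poly_iter_add: "poly_iter h (m + n) = pcompose (poly_iter h m) (poly_iter h n)"
  by (induction m) (simp_all add: poly_iter_Suc pcompose_assoc pcompose_pCons)

lemma poly_iter_mult: "poly_iter h (m * n) = poly_iter (poly_iter h m) n"
  by (induction n) (simp_all add: poly_iter_Suc poly_iter_add)

lemma poly_poly_iter: "poly (poly_iter h m) z = (poly h ^^ m) z"
  by (induction m) (simp_all add: poly_iter_Suc poly_pcompose)

lemma poly_iter_coeff_0: "coeff h 0 = 0 \<Longrightarrow> coeff (poly_iter h m) 0 = 0"
  by (induction m) (simp_all add: poly_iter_Suc coeff_pcompose_0 poly_0_coeff_0)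

lemma fps_of_poly_iter:
  fixes h :: "'a::idom poly"
  shows "coeff h 0 = 0 \<Longrightarrow> fps_of_poly (poly_iter h m) = fps_iter (fps_of_poly h) m"
  by (induction m) (simp_all add: poly_iter_Suc fps_iter_Suc fps_of_poly_pcompose poly_iter_coeff_0 fps_of_poly_pCons)

lemma poly_iter_coeff_1:
  fixes h :: "'a::idom poly"
  assumes "coeff h 0 = 0"
  shows "coeff (poly_iter h m) 1 = coeff h 1 ^ m"
  using fps_iter_nth_1[of "fps_of_poly h" m] assms fps_of_poly_iter[OF assms, of m]
  by (metis fps_of_poly_nth)

lemma poly_iter_fixed: "poly_iter h m = [:0, 1:] \<Longrightarrow> poly_iter h (m * n) = [:0, 1:]"
  unfolding poly_iter_mult by (induction n) (simp_all add: poly_iter_Suc)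

lemma ram_index_eq:
  fixes h :: "'a::field poly"
  assumes "ram_number (fps_of_poly (poly_iter h (p ^ n))) i"
  shows "ram_index p h n = i"
  unfolding ram_index_def
proof (rule Least_equality)
  show "coeff (poly_iter h (p ^ n) - [:0, 1:]) (Suc i) \<noteq> 0"
    using assms by (auto simp: ram_number_def coeff_pCons split: nat.splits)
  fix j assume "coeff (poly_iter h (p ^ n) - [:0, 1:]) (Suc j) \<noteq> 0"
  then show "i \<le> j"
    using assms by (cases "j = 0"; cases "j < i") (auto simp: ram_number_def tangent_def coeff_pCons split: nat.splits)
qed

lemma ram_number_ram_index:
  fixes h :: "'a::field poly"
  assumes "coeff h 0 = 0" "coeff h 1 = 1" "poly_iter h (p ^ n) \<noteq> [:0, 1:]"
  shows "ram_number (fps_of_poly (poly_iter h (p ^ n))) (ram_index p h n)"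
proof -
  have "fps_of_poly (poly_iter h (p ^ n)) \<noteq> fps_of_poly [:0, 1:]"
    using assms(3) by (simp only: fps_of_poly_eq_iff) simp
  then have "fps_of_poly (poly_iter h (p ^ n)) \<noteq> fps_X"
    by (simp add: fps_of_poly_pCons)
  then obtain i where "ram_number (fps_of_poly (poly_iter h (p ^ n))) i"
    using ram_number_exists poly_iter_coeff_0[OF assms(1)] poly_iter_coeff_1[OF assms(1)] assms(2)
    by (metis fps_of_poly_nth power_one)
  then show ?thesis using ram_index_eq by metis
qed

context ultrametric_residue
begin

lemma integral_poly_iter: "integral_poly P \<Longrightarrow> integral_poly (poly_iter P m)"
  by (induction m) (simp_all add: poly_iter_Suc integral_poly_pcompose)

lemma red_poly_iter: "integral_poly P \<Longrightarrow> red_poly (poly_iter P m) = poly_iter (red_poly P) m"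
  by (induction m) (simp_all add: poly_iter_Suc red_poly_pcompose integral_poly_iter)

text \<open>The reduction of the quotient is recorded during its construction: when u and w have
  equal reductions it cannot be recovered from the reduced equation by division.\<close>

lemma pcompose_difference_quotient:
  assumes "integral_poly G" "integral_poly u" "integral_poly w"
  shows "\<exists>Q. integral_poly Q \<and> pcompose G u - pcompose G w = (u - w) * Q \<and>
    (red_poly u = [:0, 1:] \<and> red_poly w = [:0, 1:] \<longrightarrow> red_poly Q = pderiv (red_poly G))"
  using assms(1)
proof (induction G)
  case 0
  then show ?case by (auto intro!: exI[of _ 0])
next
  case (pCons a G)
  then obtain Q where Q: "integral_poly Q" "pcompose G u - pcompose G w = (u - w) * Q"
    "red_poly u = [:0, 1:] \<and> red_poly w = [:0, 1:] \<longrightarrow> red_poly Q = pderiv (red_poly G)"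
    by (auto simp: integral_poly_pCons)
  have G: "integral_poly (pcompose G u)" using pCons.prems assms by (simp add: integral_poly_pCons integral_poly_pcompose)
  have "pcompose (pCons a G) u - pcompose (pCons a G) w = (u - w) * pcompose G u + w * (pcompose G u - pcompose G w)"
    by (simp add: pcompose_pCons algebra_simps)
  also have "\<dots> = (u - w) * (pcompose G u + w * Q)" unfolding Q(2) by (simp add: algebra_simps)
  finally have "pcompose (pCons a G) u - pcompose (pCons a G) w = (u - w) * (pcompose G u + w * Q)" .
  moreover have "integral_poly (pcompose G u + w * Q)"
    using G Q(1) assms by (simp add: integral_poly_add integral_poly_mult)
  moreover have "red_poly (pcompose G u + w * Q) = pderiv (red_poly (pCons a G))"
    if "red_poly u = [:0, 1:]" "red_poly w = [:0, 1:]"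
    using that Q G assms pCons.prems
    by (simp add: red_poly_add red_poly_mult integral_poly_mult red_poly_pcompose integral_poly_pCons
        red_poly_pCons pderiv_pCons)
  ultimately show ?case by blast
qed

text \<open>If f reduces to the identity, the reduced equation reads 0 = 0. The separate statement
  that C then reduces to l, thus to 0 for l = p in characteristic p, closes this case.\<close>

lemma poly_iter_quotient:
  assumes "integral_poly f"
  shows "\<exists>C. integral_poly C \<and> poly_iter f l - [:0, 1:] = (f - [:0, 1:]) * C \<and>
    (red_poly f = [:0, 1:] \<longrightarrow> red_poly C = of_nat l)"
proof (induction l)
  case 0
  then show ?case by (auto intro!: exI[of _ 0])
next
  case (Suc l)
  then obtain C where C: "integral_poly C" "poly_iter f l - [:0, 1:] = (f - [:0, 1:]) * C"
    "red_poly f = [:0, 1:] \<longrightarrow> red_poly C = of_nat l" by blast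
  obtain Q where Q: "integral_poly Q"
    "pcompose (poly_iter f l) f - pcompose (poly_iter f l) [:0, 1:] = (f - [:0, 1:]) * Q"
    "red_poly f = [:0, 1:] \<Longrightarrow> red_poly Q = pderiv (red_poly (poly_iter f l))"
    using pcompose_difference_quotient[of "poly_iter f l" f "[:0, 1:]"] assms integral_poly_iter by auto
  have "poly_iter f (Suc l) = pcompose (poly_iter f l) f"
    using poly_iter_add[of f l 1] by simp
  then have "poly_iter f (Suc l) - [:0, 1:] =
      (poly_iter f l - [:0, 1:]) + (pcompose (poly_iter f l) f - pcompose (poly_iter f l) [:0, 1:])"
    by (simp add: pcompose_idR)
  then have "poly_iter f (Suc l) - [:0, 1:] = (f - [:0, 1:]) * (C + Q)"
    unfolding Q(2) C(2) by (simp only: distrib_left)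
  moreover have "red_poly (C + Q) = of_nat (Suc l)" if f: "red_poly f = [:0, 1:]"
  proof -
    have "red_poly (poly_iter f l) = [:0, 1:]"
      using poly_iter_fixed[of "red_poly f" 1 l] f by (simp add: red_poly_iter assms)
    then show ?thesis
      using C Q f by (simp add: red_poly_add pderiv_pCons)
  qed
  ultimately show ?case using C(1) Q(1) integral_poly_add by blast
qed

end

section \<open>Linear factors and roots in the open unit disk\<close>

lemma poly_linear_factors_eq_0:
  "poly (\<Prod>x\<in>#S. [:-x, 1:]) z = 0 \<longleftrightarrow> z \<in># (S :: 'a::idom multiset)"
  by (induction S) auto

lemma double_root:
  fixes A :: "'a::idom poly"
  assumes "[:-x, 1:] * [:-x, 1:] dvd A"
  shows "poly A x = 0 \<and> poly (pderiv A) x = 0"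
proof -
  obtain E where "A = [:-x, 1:] * [:-x, 1:] * E" using assms by (rule dvdE)
  then have E: "A = [:-x, 1:] * ([:-x, 1:] * E)" by (simp only: mult.assoc)
  show ?thesis unfolding E pderiv_mult poly_add poly_mult by simp
qed

lemma squarefree_linear_factors:
  fixes A :: "'a::idom poly"
  assumes "(\<Prod>x\<in>#S. [:-x, 1:]) dvd A" and sf: "\<And>z. poly A z = 0 \<Longrightarrow> poly (pderiv A) z \<noteq> 0"
  shows "S = mset_set (set_mset S)"
proof -
  have "count S x \<le> 1" for x
  proof (rule ccontr)
    assume "\<not> count S x \<le> 1"
    then have "{#x, x#} \<subseteq># S" by (intro mset_subset_eqI) auto
    then obtain U where U: "S = {#x, x#} + U" by (metis subset_mset.le_iff_add)
    have "[:-x, 1:] * [:-x, 1:] dvd (\<Prod>x\<in>#S. [:-x, 1:])"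
      unfolding U by (simp add: mult.assoc[symmetric] del: mult_pCons_left mult_pCons_right)
    then have "[:-x, 1:] * [:-x, 1:] dvd A" using assms(1) by (rule dvd_trans)
    then show False using double_root[of x A] sf[of x] by blast
  qed
  moreover have "count S x \<ge> 1" if "x \<in># S" for x using that by simp
  ultimately have "count S x = 1" if "x \<in># S" for x using that by (meson le_antisym)
  then show ?thesis
    by (intro multiset_eqI) (auto simp: count_mset_set' not_in_iff)
qed

locale alg_closed_residue = ultrametric_residue v red
  for v :: "'a::alg_closed_field \<Rightarrow> real" and red :: "'a \<Rightarrow> 'k::field"
begin

text \<open>Factors with |x| >= 1 are rescaled to 1 - z/x, which is integral with constant term 1;
  they are collected in \<open>D\<close>, their scalars in \<open>c\<close>.\<close>

lemma linear_factors_split: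
  "\<exists>c S D. c \<noteq> 0 \<and> (\<Prod>x\<in>#A. [:-x, 1:]) = Polynomial.smult c ((\<Prod>x\<in>#S. [:-x, 1:]) * D) \<and>
     (\<forall>x\<in>#S. v x < 1) \<and> integral_poly D \<and> coeff D 0 = 1"
proof (induction A)
  case empty
  show ?case by (rule exI[of _ 1], rule exI[of _ "{#}"], rule exI[of _ 1]) simp
next
  case (add x A)
  then obtain c S D where IH: "c \<noteq> 0" "(\<Prod>x\<in>#A. [:-x, 1:]) = Polynomial.smult c ((\<Prod>x\<in>#S. [:-x, 1:]) * D)"
     "\<forall>x\<in>#S. v x < 1" "integral_poly D" "coeff D 0 = 1" by auto
  show ?case
  proof (cases "v x < 1")
    case True
    then show ?thesis using IH
      by (intro exI[of _ c] exI[of _ "add_mset x S"] exI[of _ D]) (simp add: mult_ac)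
  next
    case False
    then have x: "x \<noteq> 0" "v (- (1 / x)) \<le> 1" by (auto simp: v_divide)
    have "[:-x, 1:] = Polynomial.smult (- x) [:1, - (1 / x):]" using x by simp
    then have "(\<Prod>x\<in>#add_mset x A. [:-x, 1:]) = Polynomial.smult (- x * c) ((\<Prod>x\<in>#S. [:-x, 1:]) * ([:1, - (1 / x):] * D))"
      unfolding image_mset_add_mset prod_mset.add_mset IH(2)
      by (simp only: mult_smult_left mult_smult_right smult_smult) (simp only: mult_ac)
    moreover have "integral_poly ([:1, - (1 / x):] * D)"
      using x IH(4) by (intro integral_poly_mult) (simp_all add: integral_poly_pCons)
    moreover have "coeff ([:1, - (1 / x):] * D) 0 = 1" using IH(5) by (simp add: coeff_mult)
    ultimately show ?thesis using IH x
      by (intro exI[of _ "- x * c"] exI[of _ S] exI[of _ "[:1, - (1 / x):] * D"]) simp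
  qed
qed

lemma poly_linear_factors_0: "v (poly (\<Prod>x\<in>#S. [:-x, 1:]) 0) = (\<Prod>x\<in>#S. v x)"
  by (induction S) (simp_all add: v_mult)

lemma linear_factors_integral:
  assumes "\<forall>x\<in>#S. v x < 1"
  shows "integral_poly (\<Prod>x\<in>#S. [:-x, 1:])" 
    and "red_poly (\<Prod>x\<in>#S. [:-x, 1:]) = monom 1 (size S)"
  using assms
proof (induction S)
  case (add x S)
  {
    case 1
    then show ?case using add unfolding image_mset_add_mset prod_mset.add_mset
      by (intro integral_poly_mult) (simp_all add: integral_poly_pCons)
  next
    case 2
    then have x: "v x \<le> 1" "red x = 0" using red_eq_0[of x] by auto
    have "red_poly [:-x, 1:] = [:0, 1:]" using x by (simp add: red_poly_pCons red_uminus)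
    moreover have "integral_poly [:-x, 1:]" using x by (simp add: integral_poly_pCons)
    ultimately have "red_poly (\<Prod>x\<in>#add_mset x S. [:-x, 1:]) = [:0, 1:] * monom 1 (size S)"
      using 2 add unfolding image_mset_add_mset prod_mset.add_mset
      by (simp add: red_poly_mult del: mult_pCons_left)
    then show ?case by (simp add: monom_Suc)
  }
qed simp_all

text \<open>A form of Weierstrass preparation.\<close>
lemma roots_in_open_disk:
  assumes "integral_poly C" "C \<noteq> 0"
  obtains c S where "v c \<le> 1" "c \<noteq> 0"
    and "v (poly C 0) = v c * (\<Prod>x\<in>#S. v x)"
    and "\<And>x. x \<in># S \<longleftrightarrow> v x < 1 \<and> poly C x = 0"
    and "(\<Prod>x\<in>#S. [:-x, 1:]) dvd C"
    and "\<And>j. j < size S \<Longrightarrow> coeff (red_poly C) j = 0"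
    and "coeff (red_poly C) (size S) = red c"
    and "v c < 1 \<Longrightarrow> red_poly C = 0"
proof -
  obtain A where A: "C = Polynomial.smult (lead_coeff C) (\<Prod>x\<in>#A. [:-x, 1:])"
    using alg_closed_imp_factorization[OF assms(2)] by blast
  obtain c S D where S: "c \<noteq> 0" "(\<Prod>x\<in>#A. [:-x, 1:]) = Polynomial.smult c ((\<Prod>x\<in>#S. [:-x, 1:]) * D)"
     "\<forall>x\<in>#S. v x < 1" "integral_poly D" "coeff D 0 = 1"
    using linear_factors_split[of A] by blast
  define d where "d = lead_coeff C * c"
  define E where "E = (\<Prod>x\<in>#S. [:-x, 1:]) * D"
  have "C = Polynomial.smult (lead_coeff C) (Polynomial.smult c E)"
    unfolding E_def S(2)[symmetric] by (rule A)
  then have C: "C = Polynomial.smult d E" by (simp only: smult_smult d_def)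
  have d0: "d \<noteq> 0" using S(1) assms(2) by (simp add: d_def)
  have E: "integral_poly E" "red_poly E = monom 1 (size S) * red_poly D"
    using linear_factors_integral[OF S(3)] S(4) by (simp_all add: E_def integral_poly_mult red_poly_mult)
  have Ec: "coeff (red_poly E) j = (if j < size S then 0 else red (coeff D (j - size S)))" for j
    unfolding E(2) coeff_monom_mult by simp
  have "red (coeff E (size S)) = 1" using Ec[of "size S"] S(5) by simp
  \<comment> \<open>The unit coefficient of \<open>E\<close> in degree \<open>size S\<close> makes
    |d| the absolute value of a coefficient of C, hence at most 1.\<close>
  then have vE: "v (coeff E (size S)) = 1"
    using E(1) red_eq_0[of "coeff E (size S)"] unfolding integral_poly_def by (metis not_less_iff_gr_or_eq order_less_le zero_neq_one)
  have "v (coeff C (size S)) = v d" by (simp add: C v_mult vE)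
  then have d1: "v d \<le> 1" using assms(1) unfolding integral_poly_def by metis
  have rC: "red_poly C = Polynomial.smult (red d) (red_poly E)"
    unfolding C using d1 E(1) by (rule red_poly_smult)
  have D: "poly D z \<noteq> 0" if "v z < 1" for z
    using v_poly_eq_1[OF S(4) _ that] S(5) by force
  show ?thesis
  proof
    show "v d \<le> 1" "d \<noteq> 0" by fact+
    show "v (poly C 0) = v d * (\<Prod>x\<in>#S. v x)"
      using S(5) unfolding C E_def poly_smult poly_mult v_mult poly_linear_factors_0
      by (simp add: poly_0_coeff_0)
    show "x \<in># S \<longleftrightarrow> v x < 1 \<and> poly C x = 0" for x
      using d0 D[of x] S(3) by (auto simp: C E_def poly_linear_factors_eq_0)
    show "(\<Prod>x\<in>#S. [:-x, 1:]) dvd C" by (simp add: C E_def dvd_smult)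
    show "j < size S \<Longrightarrow> coeff (red_poly C) j = 0" for j
      unfolding rC coeff_smult Ec by simp
    show "coeff (red_poly C) (size S) = red d"
      unfolding rC coeff_smult Ec using S(5) by simp
    show "v d < 1 \<Longrightarrow> red_poly C = 0"
      using red_eq_0[OF d1] by (simp add: rC)
  qed
qed

end

section \<open>Periodic points and minimal periods\<close>

lemma funpow_min_period_inj:
  assumes "min_period f z N"
  shows "inj_on (\<lambda>j. (f ^^ j) z) {..<N}"
proof (rule linorder_inj_onI)
  fix i j assume ij: "i < j" "i \<in> {..<N}" "j \<in> {..<N}"
  show "(f ^^ i) z \<noteq> (f ^^ j) z"
  proof
    assume "(f ^^ i) z = (f ^^ j) z"
    then have "(f ^^ (N - j)) ((f ^^ i) z) = (f ^^ (N - j)) ((f ^^ j) z)" by simp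
    moreover have "(f ^^ (N - j)) ((f ^^ i) z) = (f ^^ (N - j + i)) z" by (simp add: funpow_add)
    moreover have "(f ^^ (N - j)) ((f ^^ j) z) = (f ^^ N) z"
      using ij funpow_add[of "N - j" j f] by simp
    ultimately have "(f ^^ (N - j + i)) z = z" using assms by (simp add: min_period_def)
    moreover have "0 < N - j + i" "N - j + i < N" using ij by auto
    ultimately show False using assms by (auto simp: min_period_def)
  qed
qed auto

lemma funpow_fixed_add: "(f ^^ N) z = z \<Longrightarrow> (f ^^ (j + N * k)) z = (f ^^ j) z"
proof (induction k)
  case (Suc k)
  have "(f ^^ (j + N * Suc k)) z = (f ^^ (j + N * k)) ((f ^^ N) z)"
    using funpow_add[of "j + N * k" N f] by (simp add: add_ac)
  then show ?case using Suc by simp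
qed simp

lemma min_period_dvd:
  assumes "min_period f z m" "(f ^^ N) z = z"
  shows "m dvd N"
proof -
  have "(f ^^ (N mod m + m * (N div m))) z = (f ^^ (N mod m)) z"
    using assms(1) by (intro funpow_fixed_add) (simp add: min_period_def)
  then have "(f ^^ (N mod m)) z = z" using assms(2) by simp
  moreover have "N mod m < m" using assms(1) by (simp add: min_period_def)
  ultimately have "N mod m = 0" using assms(1) unfolding min_period_def by (cases "N mod m = 0") auto
  then show ?thesis by (simp add: dvd_eq_mod_eq_0)
qed

lemma ex_min_period:
  assumes "(f ^^ N) z = z" "N > 0"
  shows "\<exists>m. min_period f z m"
proof -
  define m where "m = (LEAST m. m > 0 \<and> (f ^^ m) z = z)"
  have "m > 0 \<and> (f ^^ m) z = z"
    unfolding m_def by (rule LeastI[of _ N]) (use assms in simp)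
  moreover have "\<not> (j > 0 \<and> (f ^^ j) z = z)" if "j < m" for j
    using that not_less_Least unfolding m_def by blast
  ultimately have "min_period f z m" by (auto simp: min_period_def)
  then show ?thesis ..
qed

lemma funpow_funpow_commute: "(f ^^ m) ((f ^^ n) z) = (f ^^ n) ((f ^^ m) z)"
  using funpow_add[of m n f] funpow_add[of n m f] by (simp add: add.commute fun_eq_iff)

lemma funpow_fixed_orbit_back:
  assumes "(f ^^ N) z = z" "j \<le> N" "(f ^^ m) ((f ^^ j) z) = (f ^^ j) z"
  shows "(f ^^ m) z = z"
proof -
  have e: "(f ^^ (N - j)) ((f ^^ j) z) = z"
    using assms(1,2) funpow_add[of "N - j" j f] by simp
  have "(f ^^ m) z = (f ^^ m) ((f ^^ (N - j)) ((f ^^ j) z))" by (simp only: e)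
  also have "\<dots> = (f ^^ (N - j)) ((f ^^ m) ((f ^^ j) z))" by (rule funpow_funpow_commute)
  finally show ?thesis by (simp only: assms(3) e)
qed

section \<open>Optimal cycles\<close>

lemma root_powr_eq:
  assumes "x > (0::real)" "N \<ge> 1"
  shows "(x powr (1 / real N)) ^ N = x" and "(x ^ N) powr (1 / real N) = x"
  using assms by (simp_all add: powr_powr flip: powr_realpow)

context alg_closed_residue
begin

context
  fixes P :: "'a poly" and p q n :: nat
  assumes P: "integral_poly P" "coeff P 0 = 0" and ord: "has_order (red (coeff P 1)) q"
    and p: "prime p" "CHAR('k) = p" "\<not> p dvd q" and n: "n \<ge> 1"
begin

lemma multiplier_unit: "v (coeff P 1) = 1"
proof -
  have "red (coeff P 1) ^ q = 1" "q > 0" using ord by (auto simp: has_order_def)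
  then have "red (coeff P 1) \<noteq> 0" by (metis power_0_left zero_neq_one less_numeral_extra(3))
  then show ?thesis using P(1) red_eq_0[of "coeff P 1"] unfolding integral_poly_def
    by (metis less_eq_real_def)
qed

text \<open>P(z) = z D(z) with |D(z)| = 1 on the open disk. Constancy of |z| along orbits turns a
  product over a cycle into a power.\<close>

lemma v_orbit: "v z < 1 \<Longrightarrow> v ((poly P ^^ j) z) = v z"
proof (induction j)
  case (Suc j)
  obtain D where D: "P = pCons 0 D" using P(2) by (cases P) auto
  have "integral_poly D" "v (coeff D 0) = 1"
    using P multiplier_unit by (simp_all add: D integral_poly_pCons)
  moreover have "v ((poly P ^^ j) z) < 1" using Suc by simp
  ultimately have "v (poly D ((poly P ^^ j) z)) = 1" by (rule v_poly_eq_1)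
  then have "v (poly P ((poly P ^^ j) z)) = v ((poly P ^^ j) z)" by (simp add: D v_mult)
  then show ?case using Suc by simp
qed simp

text \<open>With \<lambda> the multiplier at 0, the point w is a root of the m-th iterate minus z,
  divided by z. The constant term \<lambda>^m - 1 of this integral polynomial is therefore not a
  unit, so the reduction of \<lambda> has m-th power 1.\<close>

lemma period_dvd:
  assumes "v w < 1" "w \<noteq> 0" "(poly P ^^ m) w = w"
  shows "q dvd m"
proof -
  obtain D where D: "poly_iter P m = pCons 0 D"
    using poly_iter_coeff_0[OF P(2)] by (metis coeff_pCons_0 pCons_cases)
  have D0: "coeff D 0 = coeff P 1 ^ m"
    using poly_iter_coeff_1[OF P(2), of m] by (simp add: D)
  have "integral_poly D" using integral_poly_iter[OF P(1), of m] by (simp add: D integral_poly_pCons)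
  then have i: "integral_poly (D - 1)" by (simp add: integral_poly_diff)
  have "poly (poly_iter P m) w = w" using assms(3) by (simp add: poly_poly_iter)
  then have "poly (D - 1) w = 0" using assms(2) by (simp add: D)
  then have "v (coeff (D - 1) 0) \<noteq> 1" using v_poly_eq_1[OF i _ assms(1)] by force
  moreover have "coeff (D - 1) 0 = coeff P 1 ^ m - 1" using D0 by simp
  moreover have "v (coeff (D - 1) 0) \<le> 1" using i unfolding integral_poly_def by blast
  ultimately have "v (coeff P 1 ^ m - 1) < 1" by simp
  moreover have "v (coeff P 1 ^ m) \<le> 1" "v (coeff P 1 ^ m - 1) \<le> 1"
    using multiplier_unit calculation by (simp_all add: v_power)
  ultimately have "red (coeff P 1 ^ m - 1) + 1 = 1" "red (coeff P 1 ^ m - 1) + 1 = red (coeff P 1 ^ m)"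
    using red_eq_0[of "coeff P 1 ^ m - 1"] red_add[of "coeff P 1 ^ m - 1" 1] by simp_all
  then have "red (coeff P 1) ^ m = 1" using multiplier_unit by (simp add: red_power)
  then show ?thesis using has_order_dvd[OF ord] by simp
qed

text \<open>\<open>C\<close> is the quotient of the overview; its value at 0 is read off from linear
  coefficients. The clause on reductions covers the case where the divisor reduces to 0, and is
  where the residue characteristic enters.\<close>

lemma cycle_polynomial:
  obtains C where "integral_poly C"
    and "poly_iter P (q * p ^ n) - [:0, 1:] = (poly_iter P (q * p ^ (n - 1)) - [:0, 1:]) * C"
    and "red_poly (poly_iter P (q * p ^ (n - 1))) = [:0, 1:] \<Longrightarrow> red_poly C = 0"
    and "coeff P 1 ^ (q * p ^ n) - 1 = (coeff P 1 ^ (q * p ^ (n - 1)) - 1) * poly C 0"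
proof -
  have N: "q * p ^ n = q * p ^ (n - 1) * p" using n by (cases n) (simp_all add: mult_ac)
  obtain C where C: "integral_poly C"
    "poly_iter (poly_iter P (q * p ^ (n - 1))) p - [:0, 1:] = (poly_iter P (q * p ^ (n - 1)) - [:0, 1:]) * C"
    "red_poly (poly_iter P (q * p ^ (n - 1))) = [:0, 1:] \<longrightarrow> red_poly C = of_nat p"
    using poly_iter_quotient[OF integral_poly_iter[OF P(1)]] by blast
  have A: "poly_iter P (q * p ^ n) - [:0, 1:] = (poly_iter P (q * p ^ (n - 1)) - [:0, 1:]) * C"
    using C(2) unfolding N poly_iter_mult .
  moreover have "of_nat p = (0 :: 'k poly)"
    using of_nat_CHAR[where 'a = 'k] p(2) by (simp add: of_nat_poly)
  moreover have "coeff P 1 ^ (q * p ^ n) - 1 = (coeff P 1 ^ (q * p ^ (n - 1)) - 1) * poly C 0"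
  proof -
    have "coeff (poly_iter P (q * p ^ n) - [:0, 1:]) 1 = coeff ((poly_iter P (q * p ^ (n - 1)) - [:0, 1:]) * C) 1"
      unfolding A ..
    then show ?thesis
      using poly_iter_coeff_1[OF P(2)] poly_iter_coeff_0[OF P(2)]
      by (simp add: coeff_mult poly_0_coeff_0)
  qed
  ultimately show ?thesis using that C by simp
qed

text \<open>Orders of vanishing add: the reduced divisor starts in degree i + 1, the reduced
  \<open>C\<close> in degree l.\<close>

lemma red_cycle_polynomial:
  assumes C: "integral_poly C"
    "poly_iter P (q * p ^ n) - [:0, 1:] = (poly_iter P (q * p ^ (n - 1)) - [:0, 1:]) * C"
    and l: "\<And>j. j < l \<Longrightarrow> coeff (red_poly C) j = 0" "coeff (red_poly C) l \<noteq> 0"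
    and i: "ram_number (fps_of_poly (poly_iter (red_poly P) (q * p ^ (n - 1)))) i"
  shows "ram_number (fps_of_poly (poly_iter (red_poly P) (q * p ^ n))) (i + l)"
proof -
  define g where "g = red_poly P"
  define B where "B = poly_iter g (q * p ^ (n - 1)) - [:0, 1:]"
  have g0: "coeff g 0 = 0" by (simp add: g_def P(2))
  have A: "poly_iter g (q * p ^ n) - [:0, 1:] = B * red_poly C"
    using arg_cong[OF C(2), of red_poly]
    by (simp add: red_poly_diff red_poly_mult integral_poly_iter P C(1) integral_poly_diff red_poly_iter B_def g_def)
  have cB: "coeff B j = (if j < i + 1 then 0 else coeff (poly_iter g (q * p ^ (n - 1))) j)" for j
    using i by (cases "j = 0"; cases "j = 1")
      (auto simp: B_def ram_number_def tangent_def coeff_pCons g_def split: nat.splits)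
  have z: "coeff B j * coeff (red_poly C) m = 0" if "j < i + 1 \<or> m < l" for j m
    using that cB l(1) by auto
  have lo: "coeff (B * red_poly C) j = 0" if "j < i + 1 + l" for j
    unfolding coeff_mult
  proof (intro sum.neutral ballI z)
    fix m assume "m \<in> {..j}"
    then show "m < i + 1 \<or> j - m < l" using that by auto
  qed
  have "coeff (B * red_poly C) (i + 1 + l) = (\<Sum>m\<in>{i + 1}. coeff B m * coeff (red_poly C) (i + 1 + l - m))"
    unfolding coeff_mult
  proof (rule sum.mono_neutral_right)
    show "\<forall>m\<in>{..i + 1 + l} - {i + 1}. coeff B m * coeff (red_poly C) (i + 1 + l - m) = 0"
    proof (intro ballI z)
      fix m assume "m \<in> {..i + 1 + l} - {i + 1}"
      then show "m < i + 1 \<or> i + 1 + l - m < l" by auto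
    qed
  qed auto
  then have hi: "coeff (B * red_poly C) (i + 1 + l) \<noteq> 0"
    using l(2) i by (simp add: cB ram_number_def g_def)
  have cA: "coeff (poly_iter g (q * p ^ n)) j = coeff (B * red_poly C) j + coeff [:0, 1:] j" for j
    unfolding A[symmetric] by simp
  have "i \<ge> 1" using i by (simp add: ram_number_def)
  then show ?thesis
    unfolding g_def[symmetric] ram_number_def tangent_def fps_of_poly_nth
    using cA lo hi by (auto simp: coeff_pCons algebra_simps split: nat.splits)
qed

lemma period_pos: "q * p ^ n \<ge> 2" 
proof -
  have "q \<ge> 1" using ord by (simp add: has_order_def)
  moreover have "p ^ n \<ge> p ^ 1" using n prime_gt_0_nat[OF p(1)] by (intro power_increasing) auto
  ultimately show ?thesis using prime_ge_2_nat[OF p(1)] mult_le_mono[of 1 q 2 "p ^ n"] by simp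
qed

lemma cycle_polynomial_root:
  assumes C: "poly_iter P (q * p ^ n) - [:0, 1:] = (poly_iter P (q * p ^ (n - 1)) - [:0, 1:]) * C"
    and w: "min_period (poly P) w (q * p ^ n)" and j: "j < q * p ^ n"
  shows "poly C ((poly P ^^ j) w) = 0"
proof -
  let ?N = "q * p ^ n" and ?N' = "q * p ^ (n - 1)"
  have fix_w: "(poly P ^^ ?N) w = w" using w by (simp add: min_period_def)
  have "p ^ (n - 1) < p ^ n" using n prime_gt_1_nat[OF p(1)] by (intro power_strict_increasing) auto
  moreover have "q > 0" using ord by (simp add: has_order_def)
  ultimately have "0 < ?N'" "?N' < ?N" using prime_gt_0_nat[OF p(1)] by auto
  then have "(poly P ^^ ?N') w \<noteq> w" using w unfolding min_period_def by blast
  then have B: "(poly P ^^ ?N') ((poly P ^^ j) w) \<noteq> (poly P ^^ j) w"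
    using funpow_fixed_orbit_back[OF fix_w less_imp_le[OF j]] by blast
  have A: "(poly P ^^ ?N) ((poly P ^^ j) w) = (poly P ^^ j) w"
    unfolding funpow_funpow_commute[of ?N "poly P" j w] fix_w ..
  have "poly (poly_iter P ?N - [:0, 1:]) x = poly (poly_iter P ?N' - [:0, 1:]) x * poly C x" for x
    unfolding C by (rule poly_mult)
  then have "(poly P ^^ ?N) x - x = ((poly P ^^ ?N') x - x) * poly C x" for x
    by (simp add: poly_poly_iter)
  from this[of "(poly P ^^ j) w"] show ?thesis using A B by simp
qed

lemma optimal_imp_unique_and_gap:
  assumes opt: "optimal_point v P q p n z0"
  shows "v w < 1 \<Longrightarrow> min_period (poly P) w (q * p ^ n) \<Longrightarrow> \<exists>j. w = (poly P ^^ j) z0"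
    and "\<exists>i. ram_number (fps_of_poly (poly_iter (red_poly P) (q * p ^ (n - 1)))) i \<and>
        ram_number (fps_of_poly (poly_iter (red_poly P) (q * p ^ n))) (i + q * p ^ n)"
proof -
  define N where "N = q * p ^ n"
  define lam where "lam = coeff P 1"
  have o: "lam ^ N \<noteq> 1" "v z0 < 1" "min_period (poly P) z0 N"
    "v z0 = (v (lam ^ N - 1) / v (lam ^ (q * p ^ (n - 1)) - 1)) powr (1 / real N)"
    using opt by (auto simp: optimal_point_def Let_def N_def lam_def)
  have N2: "N \<ge> 2" using period_pos by (simp add: N_def)
  obtain C where C: "integral_poly C"
    "poly_iter P N - [:0, 1:] = (poly_iter P (q * p ^ (n - 1)) - [:0, 1:]) * C"
    "red_poly (poly_iter P (q * p ^ (n - 1))) = [:0, 1:] \<Longrightarrow> red_poly C = 0"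
    "lam ^ N - 1 = (lam ^ (q * p ^ (n - 1)) - 1) * poly C 0"
    using cycle_polynomial unfolding N_def lam_def by metis
  have C00: "poly C 0 \<noteq> 0" and l': "lam ^ (q * p ^ (n - 1)) - 1 \<noteq> 0" using C(4) o(1) by auto
  then have "C \<noteq> 0" by auto
  obtain c S where S: "v c \<le> 1" "c \<noteq> 0" "v (poly C 0) = v c * (\<Prod>x\<in>#S. v x)"
    "\<And>x. x \<in># S \<longleftrightarrow> v x < 1 \<and> poly C x = 0"
    "\<And>j. j < size S \<Longrightarrow> coeff (red_poly C) j = 0" "coeff (red_poly C) (size S) = red c"
    using roots_in_open_disk[OF C(1) \<open>C \<noteq> 0\<close>] by metis
  define Orb where "Orb = (\<lambda>j. (poly P ^^ j) z0) ` {..<N}"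
  have fin_Orb: "finite Orb" and card_Orb: "card Orb = N"
    using card_image[OF funpow_min_period_inj[OF o(3)]] by (auto simp: Orb_def)
  have v_Orb: "v x = v z0" if "x \<in> Orb" for x using that v_orbit[OF o(2)] by (auto simp: Orb_def)
  have Orb_S: "x \<in># S" if "x \<in> Orb" for x
    using that v_Orb[OF that] o(2) S(4) cycle_polynomial_root[OF C(2)[unfolded N_def] o(3)[unfolded N_def]]
    by (auto simp: Orb_def N_def)
  then have "mset_set Orb \<subseteq># S"
    using fin_Orb by (intro mset_subset_eqI) (auto simp: count_mset_set' Suc_le_eq)
  then obtain T where T: "S = mset_set Orb + T" by (metis subset_mset.le_iff_add)
  have z0: "z0 \<noteq> 0"
  proof
    assume "z0 = 0"
    then have "(poly P ^^ 1) z0 = z0" using P(2) by (simp add: poly_0_coeff_0)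
    then show False using o(3) N2 unfolding min_period_def by auto
  qed
  have "v (poly C 0) = v z0 ^ N"
  proof -
    have e: "v (poly C 0) = v (lam ^ N - 1) / v (lam ^ (q * p ^ (n - 1)) - 1)"
      unfolding C(4) v_mult using l' by simp
    have "v (poly C 0) > 0" using C00 v_nonneg[of "poly C 0"] v_eq_0[of "poly C 0"] by linarith
    then show ?thesis
      using o(4) N2 root_powr_eq(1)[of "v (poly C 0)" N] unfolding e[symmetric] by simp
  qed
  moreover have "(\<Prod>x\<in>#mset_set Orb. v x) = v z0 ^ N"
  proof -
    have "(\<Prod>x\<in>#mset_set Orb. v x) = (\<Prod>x\<in>Orb. v x)" by (simp add: prod_unfold_prod_mset)
    also have "\<dots> = (\<Prod>x\<in>Orb. v z0)" by (intro prod.cong) (simp_all add: v_Orb)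
    finally show ?thesis by (simp add: card_Orb)
  qed
  \<comment> \<open>|z0|^N is both |C(0)| and the contribution of the orbit; cancelling it leaves
    |c| times the other roots. All these factors are at most 1, and those from \<open>T\<close> are
    less than 1, so \<open>T\<close> is empty and \<open>c\<close> is a unit.\<close>
  ultimately have prod1: "v c * (\<Prod>x\<in>#T. v x) = 1"
    using S(3) z0 by (simp add: T)
  have T1: "\<forall>x\<in>#T. v x < 1" using S(4) T by auto
  have le1: "(\<Prod>x\<in>#U. v x) \<le> 1 \<and> (\<Prod>x\<in>#U. v x) \<ge> 0" if "\<forall>x\<in>#U. v x < 1" for U
    using that
  proof (induction U)
    case (add x U)
    then have "v x \<le> 1" "(\<Prod>x\<in>#U. v x) \<le> 1" "(\<Prod>x\<in>#U. v x) \<ge> 0" by auto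
    then show ?case by (simp add: mult_le_one)
  qed simp
  have Te: "T = {#}"
  proof (rule ccontr)
    assume "T \<noteq> {#}"
    then obtain x U where U: "T = add_mset x U" by (metis multiset_cases)
    have "(\<Prod>x\<in>#T. v x) \<le> v x * 1"
      using le1[of U] T1 mult_left_mono[of "\<Prod>x\<in>#U. v x" 1 "v x"] by (simp add: U)
    also have "\<dots> < 1" using T1 by (simp add: U)
    finally have "v c * (\<Prod>x\<in>#T. v x) < 1"
      using S(1) le1[OF T1] by (metis mult_left_le_one_le order_le_less_trans v_nonneg)
    then show False using prod1 by simp
  qed
  then have vc: "v c = 1" using prod1 by simp
  have sizeS: "size S = N" using T Te card_Orb fin_Orb by simp
  show "\<exists>j. w = (poly P ^^ j) z0" if "v w < 1" "min_period (poly P) w (q * p ^ n)"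
  proof -
    have "0 < q * p ^ n" using period_pos by linarith
    then have "poly C w = 0"
      using cycle_polynomial_root[OF C(2)[unfolded N_def] that(2), of 0] by simp
    then have "w \<in># S" using that S(4) by simp
    then show ?thesis using T Te fin_Orb by (auto simp: Orb_def)
  qed
  have rc: "red c \<noteq> 0" using red_eq_0[of c] vc by simp
  then have "red_poly C \<noteq> 0" using S(6) by (metis coeff_0)
  \<comment> \<open>Were this iterate the identity, \<open>C\<close> would reduce to 0; so the lower
    ramification number exists.\<close>
  then have "poly_iter (red_poly P) (q * p ^ (n - 1)) \<noteq> [:0, 1:]"
    using C(3) red_poly_iter[OF P(1)] by metis
  moreover have "coeff (poly_iter (red_poly P) (q * m)) 1 = 1" for m
  proof -
    have "coeff (red_poly P) 1 ^ q = 1" using ord by (simp add: has_order_def)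
    then show ?thesis using poly_iter_coeff_1[of "red_poly P" "q * m"] P(2) by (simp add: power_mult)
  qed
  ultimately have "\<exists>i. ram_number (fps_of_poly (poly_iter (red_poly P) (q * p ^ (n - 1)))) i"
    using poly_iter_coeff_0[of "red_poly P"] P(2)
    by (intro ram_number_exists) (auto simp flip: fps_of_poly_fps_X simp: fps_of_poly_eq_iff)
  then obtain i where i: "ram_number (fps_of_poly (poly_iter (red_poly P) (q * p ^ (n - 1)))) i" ..
  then have "ram_number (fps_of_poly (poly_iter (red_poly P) (q * p ^ n))) (i + q * p ^ n)"
    using red_cycle_polynomial[OF C(1) C(2)[unfolded N_def], of "size S"] S(5,6) rc sizeS
    unfolding N_def by metis
  then show "\<exists>i. ram_number (fps_of_poly (poly_iter (red_poly P) (q * p ^ (n - 1)))) i \<and>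
        ram_number (fps_of_poly (poly_iter (red_poly P) (q * p ^ n))) (i + q * p ^ n)"
    using i by blast
qed

lemma squarefree_gap_imp_optimal:
  assumes gap: "ram_number (fps_of_poly (poly_iter (red_poly P) (q * p ^ (n - 1)))) i"
      "ram_number (fps_of_poly (poly_iter (red_poly P) (q * p ^ n))) (i + q * p ^ n)"
    and sf: "\<And>z. (poly P ^^ (q * p ^ n)) z = z \<Longrightarrow> poly (pderiv (poly_iter P (q * p ^ n))) z \<noteq> 1"
  shows "has_optimal_cycle v P q p n"
proof -
  define N where "N = q * p ^ n"
  define N' where "N' = q * p ^ (n - 1)"
  define lam where "lam = coeff P 1"
  define A where "A = poly_iter P N - [:0, 1:]"
  define B where "B = poly_iter P N' - [:0, 1:]"
  have sf': "poly (pderiv A) z \<noteq> 0" if "poly A z = 0" for z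
    using sf[of z] that by (simp add: A_def N_def poly_poly_iter pderiv_diff pderiv_pCons)
  have N2: "N \<ge> 2" using period_pos by (simp add: N_def)
  have q0: "q > 0" using ord by (simp add: has_order_def)
  obtain C where C: "integral_poly C" "A = B * C"
    "red_poly (poly_iter P N') = [:0, 1:] \<Longrightarrow> red_poly C = 0"
    "lam ^ N - 1 = (lam ^ N' - 1) * poly C 0"
    using cycle_polynomial unfolding A_def B_def N_def N'_def lam_def by metis
  have A0: "poly A 0 = 0" and B0: "poly B 0 = 0"
    using poly_iter_coeff_0[OF P(2)] by (simp_all add: A_def B_def poly_0_coeff_0)
  have "poly (pderiv A) 0 = lam ^ N - 1"
    using poly_iter_coeff_1[OF P(2), of N] by (simp add: poly_0_coeff_0 coeff_pderiv A_def lam_def)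
  \<comment> \<open>The hypothesis on multipliers is applied at the fixed point 0, where the
    multiplier is \<lambda>^N.\<close>
  then have lamN: "lam ^ N \<noteq> 1" using sf'[OF A0] by auto
  then have C00: "poly C 0 \<noteq> 0" and l': "lam ^ N' - 1 \<noteq> 0" using C(4) by auto
  then have "C \<noteq> 0" by auto
  obtain c S where S: "v c \<le> 1" "c \<noteq> 0" "v (poly C 0) = v c * (\<Prod>x\<in>#S. v x)"
    "\<And>x. x \<in># S \<longleftrightarrow> v x < 1 \<and> poly C x = 0" "(\<Prod>x\<in>#S. [:-x, 1:]) dvd C"
    "\<And>j. j < size S \<Longrightarrow> coeff (red_poly C) j = 0" "coeff (red_poly C) (size S) = red c"
    "v c < 1 \<Longrightarrow> red_poly C = 0"
    using roots_in_open_disk[OF C(1) \<open>C \<noteq> 0\<close>] by metis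
  have rA: "poly_iter (red_poly P) N - [:0, 1:] = (poly_iter (red_poly P) N' - [:0, 1:]) * red_poly C"
    using arg_cong[OF C(2), of red_poly] unfolding A_def B_def
    by (simp add: red_poly_diff red_poly_mult integral_poly_iter P C(1) integral_poly_diff red_poly_iter)
  have "red_poly C \<noteq> 0"
  proof
    assume "red_poly C = 0"
    then have "poly_iter (red_poly P) N = [:0, 1:]" using rA by simp
    then show False using gap(2) ram_number_not_X by (auto simp: N_def fps_of_poly_pCons)
  qed
  \<comment> \<open>A finite ramification number at level n excludes \<open>C\<close> reducing to 0.
    So \<open>c\<close> is a unit and the number of roots is the order of the reduced
    \<open>C\<close>, which the gap identifies as N.\<close>
  then have vc: "v c = 1" using S(1,8) by force
  then have rc: "red c \<noteq> 0" using red_eq_0[of c] by simp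
  have "ram_number (fps_of_poly (poly_iter (red_poly P) (q * p ^ n))) (i + size S)"
    using red_cycle_polynomial[OF C(1) C(2)[unfolded A_def B_def N_def N'_def], of "size S"] S(6,7) rc gap(1) by metis
  then have sizeS: "size S = N" using ram_number_unique[OF gap(2)] by (fastforce simp: N_def)
  have "(\<Prod>x\<in>#S. [:-x, 1:]) dvd A" using S(5) C(2) by (simp add: dvd_mult)
  then have S_set: "S = mset_set (set_mset S)"
    using squarefree_linear_factors sf' by blast
  have cardS: "card (set_mset S) = N" using sizeS S_set by (metis size_mset_set)
  have "set_mset S \<noteq> {}" using cardS N2 by auto
  then obtain r where r: "r \<in># S" by blast
  have vr: "v r < 1" "poly C r = 0" using r S(4) by auto
  \<comment> \<open>A common root of \<open>B\<close> and \<open>C\<close> would be a double root of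
    \<open>A\<close>.\<close>
  have Br: "poly B r \<noteq> 0"
  proof
    assume "poly B r = 0"
    then have "[:-r, 1:] dvd B" "[:-r, 1:] dvd C" using vr by (simp_all add: poly_eq_0_iff_dvd)
    then have "[:-r, 1:] * [:-r, 1:] dvd A" unfolding C(2) by (rule mult_dvd_mono)
    then show False using double_root sf' by blast
  qed
  have "poly A r = 0" using vr C(2) by simp
  then have rN: "(poly P ^^ N) r = r" by (simp add: A_def poly_poly_iter)
  obtain m where m: "min_period (poly P) r m" using ex_min_period[OF rN] N2 by auto
  have mr: "(poly P ^^ m) r = r" "m > 0" using m by (auto simp: min_period_def)
  have mN: "m dvd q * p ^ n" using min_period_dvd[OF m rN] by (simp add: N_def)
  have "r \<noteq> 0" using B0 Br by auto
  then obtain m' where m': "m = q * m'" using period_dvd[OF vr(1) _ mr(1)] by auto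
  then have "m' dvd p ^ n" using mN q0 by simp
  then obtain e where e: "m' = p ^ e" "e \<le> n" using divides_primepow_nat[OF p(1)] by blast
  \<comment> \<open>The period is q p^e with e <= n; for e < n it would divide N', and r would be a
    root of \<open>B\<close>.\<close>
  have "m = N"
  proof (rule ccontr)
    assume "m \<noteq> N"
    then have "e < n" using e m' by (auto simp: N_def le_less)
    then have "p ^ e dvd p ^ (n - 1)" by (intro le_imp_power_dvd) simp
    then obtain k where "N' = m * k" by (auto simp: N'_def m' e elim!: dvdE)
    then have "(poly P ^^ N') r = r" using funpow_fixed_add[OF mr(1), of 0 k] by simp
    then show False using Br by (simp add: B_def poly_poly_iter)
  qed
  then have rper: "min_period (poly P) r N" using m by simp
  define Orb where "Orb = (\<lambda>j. (poly P ^^ j) r) ` {..<N}"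
  have fin_Orb: "finite Orb" and card_Orb: "card Orb = N"
    using card_image[OF funpow_min_period_inj[OF rper]] by (auto simp: Orb_def)
  have v_Orb: "v x = v r" if "x \<in> Orb" for x using that v_orbit[OF vr(1)] by (auto simp: Orb_def)
  have Orb_S: "x \<in># S" if "x \<in> Orb" for x
    using that v_Orb[OF that] vr S(4) cycle_polynomial_root[OF C(2)[unfolded A_def B_def N_def N'_def] rper[unfolded N_def]]
    by (auto simp: Orb_def N_def)
  then have "Orb = set_mset S" using card_Orb cardS by (intro card_subset_eq) auto
  then have "(\<Prod>x\<in>#S. v x) = (\<Prod>x\<in>Orb. v x)"
    using S_set by (simp add: prod_unfold_prod_mset)
  also have "\<dots> = (\<Prod>x\<in>Orb. v r)" by (intro prod.cong) (simp_all add: v_Orb)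
  also have "\<dots> = v r ^ N" by (simp add: card_Orb)
  finally have "v (poly C 0) = v r ^ N" using S(3) vc by simp
  moreover have "v (poly C 0) = v (lam ^ N - 1) / v (lam ^ N' - 1)"
    unfolding C(4) v_mult using l' by simp
  ultimately have e: "v (lam ^ N - 1) / v (lam ^ N' - 1) = v r ^ N" by simp
  have "v r > 0" using \<open>r \<noteq> 0\<close> v_nonneg[of r] v_eq_0[of r] by linarith
  then have "v r = (v (lam ^ N - 1) / v (lam ^ N' - 1)) powr (1 / real N)"
    unfolding e using N2 root_powr_eq(2)[of "v r" N] by simp
  then have "optimal_point v P q p n r"
    using lamN vr(1) rper by (simp add: optimal_point_def Let_def N_def N'_def lam_def)
  then show ?thesis by (auto simp: has_optimal_cycle_def)
qed

end

end

section \<open>Generic nondegeneracy\<close>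

text \<open>Polynomial functions with integer coefficients, encoded by closure properties: that a
  determinant belongs to the class follows from its shape alone. Integers suffice because they land
  in the prime field in every characteristic.\<close>

inductive int_poly_fun :: "nat \<Rightarrow> ((nat \<Rightarrow> 'a::field) \<Rightarrow> 'a) \<Rightarrow> bool" for d where
  const: "int_poly_fun d (\<lambda>a. of_int c)"
| var: "i \<in> {1..d} \<Longrightarrow> int_poly_fun d (\<lambda>a. a i)"
| add: "int_poly_fun d f \<Longrightarrow> int_poly_fun d h \<Longrightarrow> int_poly_fun d (\<lambda>a. f a + h a)"
| mult: "int_poly_fun d f \<Longrightarrow> int_poly_fun d h \<Longrightarrow> int_poly_fun d (\<lambda>a. f a * h a)"

lemma int_poly_fun_0: "int_poly_fun d (\<lambda>a. 0)"
  and int_poly_fun_1: "int_poly_fun d (\<lambda>a. 1)"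
  and int_poly_fun_of_nat: "int_poly_fun d (\<lambda>a. of_nat n)"
  using int_poly_fun.const[of d 0] int_poly_fun.const[of d 1] int_poly_fun.const[of d "int n"] by simp_all

lemma int_poly_fun_diff: "int_poly_fun d f \<Longrightarrow> int_poly_fun d h \<Longrightarrow> int_poly_fun d (\<lambda>a. f a - h a)"
  using int_poly_fun.add[OF _ int_poly_fun.mult[OF int_poly_fun.const[of d "- 1"]], of f h] by simp

lemma int_poly_fun_sum: "(\<And>i. i \<in> S \<Longrightarrow> int_poly_fun d (f i)) \<Longrightarrow> int_poly_fun d (\<lambda>a. \<Sum>i\<in>S. f i a)"
  by (induction S rule: infinite_finite_induct) (simp_all add: int_poly_fun_0 int_poly_fun.add)

lemma int_poly_fun_prod: "(\<And>i. i \<in> S \<Longrightarrow> int_poly_fun d (f i)) \<Longrightarrow> int_poly_fun d (\<lambda>a. \<Prod>i\<in>S. f i a)"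
  by (induction S rule: infinite_finite_induct) (simp_all add: int_poly_fun_1 int_poly_fun.mult)

lemma int_poly_fun_power: "int_poly_fun d f \<Longrightarrow> int_poly_fun d (\<lambda>a. f a ^ n)"
  by (induction n) (simp_all add: int_poly_fun_1 int_poly_fun.mult)

definition term_fun :: "nat \<Rightarrow> (nat \<Rightarrow> 'a::field) \<Rightarrow> int \<times> (nat \<Rightarrow> nat) \<Rightarrow> 'a" where
  "term_fun d a t = of_int (fst t) * (\<Prod>i\<in>{1..d}. a i ^ snd t i)"

lemma term_fun_mult:
  "term_fun d a (c * c', \<lambda>i. e i + e' i) = term_fun d a (c, e) * term_fun d a (c', e')"
  by (simp add: term_fun_def power_add prod.distrib mult_ac)

text \<open>A list of monomials may repeat an exponent vector, so sums are concatenations and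
  products list all pairs. Equal exponents are merged only on passing to coefficient
  functions.\<close>

lemma int_poly_fun_terms:
  assumes "int_poly_fun d f"
  shows "\<exists>ts. (\<forall>t\<in>set ts. \<forall>i. i \<notin> {1..d} \<longrightarrow> snd t i = 0) \<and> (\<forall>a. f a = sum_list (map (term_fun d a) ts))"
  using assms
proof induction
  case (const c)
  show ?case by (rule exI[of _ "[(c, \<lambda>_. 0)]"]) (simp add: term_fun_def)
next
  case (var i)
  have "(\<Prod>j\<in>{1..d}. a j ^ (if j = i then 1 else 0)) = a i" for a :: "nat \<Rightarrow> 'a"
  proof -
    have "(\<Prod>j\<in>{1..d}. a j ^ (if j = i then 1 else 0)) = (\<Prod>j\<in>{1..d}. if j = i then a j else 1)"
      by (intro prod.cong) auto
    then show ?thesis using var by (simp add: prod.delta)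
  qed
  then show ?case using var
    by (intro exI[of _ "[(1, \<lambda>j. if j = i then 1 else 0)]"]) (simp add: term_fun_def)
next
  case (add f h)
  then obtain ts us where "\<forall>t\<in>set ts. \<forall>i. i \<notin> {1..d} \<longrightarrow> snd t i = 0" "\<forall>a. f a = sum_list (map (term_fun d a) ts)"
    "\<forall>t\<in>set us. \<forall>i. i \<notin> {1..d} \<longrightarrow> snd t i = 0" "\<forall>a. h a = sum_list (map (term_fun d a) us)" by blast
  then show ?case by (intro exI[of _ "ts @ us"]) auto
next
  case (mult f h)
  then obtain ts us where ts: "\<forall>t\<in>set ts. \<forall>i. i \<notin> {1..d} \<longrightarrow> snd t i = 0" "\<forall>a. f a = sum_list (map (term_fun d a) ts)"
    and us: "\<forall>t\<in>set us. \<forall>i. i \<notin> {1..d} \<longrightarrow> snd t i = 0" "\<forall>a. h a = sum_list (map (term_fun d a) us)" by blast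
  define mul :: "int \<times> (nat \<Rightarrow> nat) \<Rightarrow> int \<times> (nat \<Rightarrow> nat) \<Rightarrow> int \<times> (nat \<Rightarrow> nat)"
    where "mul t u = (fst t * fst u, \<lambda>i. snd t i + snd u i)" for t u
  have m1: "sum_list (map (term_fun d a) (map (mul t) us)) = term_fun d a t * sum_list (map (term_fun d a) us)"
    for a :: "nat \<Rightarrow> 'a" and t
    by (simp add: mul_def term_fun_mult comp_def flip: sum_list_const_mult)
  have "sum_list (map (term_fun d a) (concat (map (\<lambda>t. map (mul t) us) ts))) =
      sum_list (map (term_fun d a) ts) * sum_list (map (term_fun d a) us)" for a :: "nat \<Rightarrow> 'a"
    by (induction ts) (simp_all add: m1[simplified] distrib_right)
  moreover have "\<forall>t\<in>set (concat (map (\<lambda>t. map (mul t) us) ts)). \<forall>i. i \<notin> {1..d} \<longrightarrow> snd t i = 0"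
    using ts(1) us(1) by (auto simp: mul_def)
  ultimately show ?case
    using ts(2) us(2) by (intro exI[of _ "concat (map (\<lambda>t. map (mul t) us) ts)"]) (simp del: map_concat)
qed

lemma int_poly_fun_imp_mpoly:
  fixes f :: "(nat \<Rightarrow> 'a::field) \<Rightarrow> 'a"
  assumes "int_poly_fun d f"
  shows "\<exists>R. is_mpoly_over prime_subfield d R \<and> (\<forall>a. mpoly_eval d R a = f a)"
proof -
  obtain ts where ts: "\<forall>t\<in>set ts. \<forall>i. i \<notin> {1..d} \<longrightarrow> snd t i = 0" "\<forall>a. f a = sum_list (map (term_fun d a) ts)"
    using int_poly_fun_terms[OF assms] by blast
  define c where "c ts e = sum_list (map (\<lambda>t. if snd t = e then fst t else 0) ts)" for ts :: "(int \<times> (nat \<Rightarrow> nat)) list" and e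
  define R :: "(nat \<Rightarrow> nat) \<Rightarrow> 'a" where "R e = of_int (c ts e)" for e
  have c0: "c ts e = 0" if "e \<notin> snd ` set ts" for ts e
    using that by (induction ts) (auto simp: c_def)
  have supp: "{e. R e \<noteq> 0} \<subseteq> snd ` set ts" using c0 by (force simp: R_def)
  have "(\<Sum>e\<in>E. of_int (c us e) * (\<Prod>i\<in>{1..d}. a i ^ e i)) = sum_list (map (term_fun d a) us)"
    if "finite E" "snd ` set us \<subseteq> E" for E us and a :: "nat \<Rightarrow> 'a"
    using that(2)
  proof (induction us)
    case Nil
    then show ?case by (simp add: c_def)
  next
    case (Cons u us)
    have "(\<Sum>e\<in>E. of_int (c (u # us) e) * (\<Prod>i\<in>{1..d}. a i ^ e i)) =
      (\<Sum>e\<in>E. (if snd u = e then of_int (fst u) * (\<Prod>i\<in>{1..d}. a i ^ e i) else 0)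
          + of_int (c us e) * (\<Prod>i\<in>{1..d}. a i ^ e i))"
      by (intro sum.cong) (simp_all add: c_def distrib_right)
    then show ?case using Cons that(1) by (simp add: sum.distrib sum.delta term_fun_def)
  qed
  note e = this
  have "mpoly_eval d R a = (\<Sum>e\<in>snd ` set ts. R e * (\<Prod>i\<in>{1..d}. a i ^ e i))" for a
    unfolding mpoly_eval_def by (rule sum.mono_neutral_left) (use supp in auto)
  then have "mpoly_eval d R a = f a" for a using e[of "snd ` set ts" ts a] ts(2) by (simp add: R_def)
  moreover have "R e \<in> prime_subfield" for e
    unfolding prime_subfield_def R_def by (intro CollectI exI[of _ "c ts e"] exI[of _ 1]) simp
  moreover have "finite {e. R e \<noteq> 0}" using supp by (rule finite_subset) simp
  moreover have "e i = 0" if "R e \<noteq> 0" "i \<notin> {1..d}" for e i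
  proof -
    have "e \<in> snd ` set ts" using supp that(1) by auto
    then obtain t where "t \<in> set ts" "e = snd t" by (rule imageE)
    then show ?thesis using ts(1) that(2) by simp
  qed
  ultimately show ?thesis unfolding is_mpoly_over_def by (intro exI[of _ R]) simp
qed

definition int_poly_family :: "nat \<Rightarrow> ((nat \<Rightarrow> 'a::field) \<Rightarrow> 'a poly) \<Rightarrow> bool" where
  "int_poly_family d F \<longleftrightarrow> (\<forall>k. int_poly_fun d (\<lambda>a. coeff (F a) k))"

lemma int_poly_family_mult:
  "int_poly_family d F \<Longrightarrow> int_poly_family d H \<Longrightarrow> int_poly_family d (\<lambda>a. F a * H a)"
  by (auto simp: int_poly_family_def coeff_mult intro!: int_poly_fun_sum int_poly_fun.mult)

lemma int_poly_family_const: "int_poly_family d (\<lambda>a. monom 1 i)"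
  by (auto simp: int_poly_family_def int_poly_fun_0 int_poly_fun_1)

lemma int_poly_family_power: "int_poly_family d F \<Longrightarrow> int_poly_family d (\<lambda>a. F a ^ n)"
proof (induction n)
  case 0
  show ?case using int_poly_family_const[of d 0] by (simp add: monom_0 one_pCons)
qed (simp add: int_poly_family_mult)

lemma int_poly_family_diff:
  "int_poly_family d F \<Longrightarrow> int_poly_family d H \<Longrightarrow> int_poly_family d (\<lambda>a. F a - H a)"
  by (simp add: int_poly_family_def int_poly_fun_diff)

lemma int_poly_family_pderiv: "int_poly_family d F \<Longrightarrow> int_poly_family d (\<lambda>a. pderiv (F a))"
  unfolding int_poly_family_def coeff_pderiv
  by (intro allI int_poly_fun.mult int_poly_fun_of_nat) simp

lemma pcompose_monom: "pcompose (monom c i) r = Polynomial.smult c (r ^ i)" for r :: "'a::comm_ring_1 poly"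
  by (induction i) (simp_all add: monom_0 monom_Suc pcompose_pCons mult_ac)

lemma int_poly_family_iter:
  "int_poly_family d (\<lambda>a. poly_iter (\<Sum>i=1..d. monom (a i) i) m)"
proof (induction m)
  case 0
  show ?case using int_poly_family_const[of d 1] by (simp add: monom_Suc monom_0)
next
  case (Suc m)
  have "poly_iter (\<Sum>i=1..d. monom (a i) i) (Suc m) =
     (\<Sum>i=1..d. Polynomial.smult (a i) (poly_iter (\<Sum>i=1..d. monom (a i) i) m ^ i))" for a :: "nat \<Rightarrow> 'a"
    by (simp add: poly_iter_Suc pcompose_sum pcompose_monom)
  then show ?case
    using int_poly_family_power[OF Suc]
    by (auto simp: int_poly_family_def coeff_sum intro!: int_poly_fun_sum int_poly_fun.mult int_poly_fun.var)
qed

section \<open>The resultant of a polynomial and its derivative\<close>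

definition disc_row :: "nat \<Rightarrow> 'a::field poly \<Rightarrow> nat \<Rightarrow> 'a poly" where
  "disc_row D A i = (if i < D - 1 then monom 1 i * A else monom 1 (i - (D - 1)) * pderiv A)"

text \<open>The Sylvester determinant of A and A' for the formal degree D: D - 1 shifts of A and D
  shifts of A'. A fixed D makes it a single integer polynomial in the coefficients for the whole
  family.\<close>

definition disc_det :: "nat \<Rightarrow> 'a::field poly \<Rightarrow> 'a" where
  "disc_det D A = Determinant.det (mat (2 * D - 1) (2 * D - 1) (\<lambda>(i, j). coeff (disc_row D A i) j))"

lemma degree_disc_row:
  assumes "degree A \<le> D" "i < 2 * D - 1"
  shows "degree (disc_row D A i) \<le> 2 * D - 2"
proof (cases "i < D - 1")
  case True
  have "degree (monom 1 i * A) \<le> i + degree A"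
    using degree_mult_le[of "monom 1 i" A] degree_monom_le[of "1::'a" i] by linarith
  then show ?thesis using True assms by (simp add: disc_row_def)
next
  case False
  have "degree (pderiv A) \<le> D - 1"
    using assms(1) by (intro degree_le) (auto simp: coeff_pderiv coeff_eq_0)
  then have "degree (monom 1 (i - (D - 1)) * pderiv A) \<le> i - (D - 1) + (D - 1)"
    using degree_mult_le[of "monom 1 (i - (D - 1))" "pderiv A"] degree_monom_le[of "1::'a" "i - (D - 1)"] by linarith
  then show ?thesis using False assms by (simp add: disc_row_def)
qed

text \<open>The vector of powers of the common root z lies in the kernel, since a row paired with it
  gives the value at z of a shift of A or A'. The argument covers degree A < D as well.\<close>

lemma disc_det_common_root:
  assumes "degree A \<le> D" "D \<ge> 1" "poly A z = 0" "poly (pderiv A) z = 0"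
  shows "disc_det D A = 0"
proof -
  define n where "n = 2 * D - 1"
  define M where "M = mat n n (\<lambda>(i, j). coeff (disc_row D A i) j)"
  define w where "w = vec n (\<lambda>j. z ^ j)"
  have "M *\<^sub>v w = 0\<^sub>v n"
  proof (rule eq_vecI)
    fix i assume "i < dim_vec (0\<^sub>v n :: 'a vec)"
    then have i: "i < n" by simp
    have "vec_index (M *\<^sub>v w) i = (\<Sum>j\<in>{0..<n}. coeff (disc_row D A i) j * z ^ j)"
      using i by (simp add: M_def w_def scalar_prod_def)
    also have "\<dots> = poly (disc_row D A i) z"
    proof -
      have "\<forall>j\<in>{0..<n} - {..degree (disc_row D A i)}. coeff (disc_row D A i) j * z ^ j = 0"
        by (auto intro: coeff_eq_0)
      moreover have "{..degree (disc_row D A i)} \<subseteq> {0..<n}"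
        using degree_disc_row[OF assms(1), of i] i assms(2) by (auto simp: n_def)
      ultimately show ?thesis unfolding poly_altdef by (intro sum.mono_neutral_right) auto
    qed
    also have "\<dots> = 0" using assms(3,4) by (simp add: disc_row_def)
    finally show "vec_index (M *\<^sub>v w) i = vec_index (0\<^sub>v n) i" using i by simp
  qed (simp add: M_def)
  moreover have "w \<noteq> 0\<^sub>v n"
  proof
    assume "w = 0\<^sub>v n"
    then have "vec_index w 0 = vec_index (0\<^sub>v n :: 'a vec) 0" by simp
    then show False using assms(2) by (simp add: w_def n_def)
  qed
  moreover have "M \<in> carrier_mat n n" "w \<in> carrier_vec n" by (simp_all add: M_def w_def)
  ultimately show ?thesis
    unfolding disc_det_def n_def[symmetric] M_def[symmetric]
    using det_0_iff_vec_prod_zero_field by blast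
qed

text \<open>A kernel vector of the transpose is a relation U A + V A' = 0 with deg V < D. At the D
  distinct roots of A the derivative is nonzero, so V vanishes there; hence V = 0, and then U =
  0.\<close>

lemma disc_det_nonzero:
  fixes A :: "'a::alg_closed_field poly"
  assumes deg: "degree A = D" "D \<ge> 1" and sf: "\<And>z. poly A z = 0 \<Longrightarrow> poly (pderiv A) z \<noteq> 0"
  shows "disc_det D A \<noteq> 0"
proof
  assume d0: "disc_det D A = 0"
  define n where "n = 2 * D - 1"
  define M where "M = mat n n (\<lambda>(i, j). coeff (disc_row D A i) j)"
  have M: "M \<in> carrier_mat n n" by (simp add: M_def)
  have "Determinant.det (transpose_mat M) = 0"
    using d0 det_transpose[OF M] by (simp add: disc_det_def n_def M_def)
  then obtain w where w: "w \<in> carrier_vec n" "w \<noteq> 0\<^sub>v n" "transpose_mat M *\<^sub>v w = 0\<^sub>v n"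
    using det_0_iff_vec_prod_zero_field[of "transpose_mat M" n] M by auto
  have comb: "(\<Sum>i\<in>{0..<n}. Polynomial.smult (vec_index w i) (disc_row D A i)) = 0"
  proof (rule poly_eqI)
    fix j
    show "coeff (\<Sum>i\<in>{0..<n}. Polynomial.smult (vec_index w i) (disc_row D A i)) j = coeff 0 j"
    proof (cases "j < n")
      case True
      have "vec_index (transpose_mat M *\<^sub>v w) j = (\<Sum>i\<in>{0..<n}. coeff (disc_row D A i) j * vec_index w i)"
        using True w(1) by (simp add: M_def scalar_prod_def)
      then show ?thesis using w(3) True by (simp add: coeff_sum mult.commute)
    next
      case False
      have "coeff (disc_row D A i) j = 0" if "i < n" for i
        using degree_disc_row[of A D i] that deg False by (intro coeff_eq_0) (simp add: n_def)
      then show ?thesis by (simp add: coeff_sum)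
    qed
  qed
  define U where "U = (\<Sum>i\<in>{0..<D - 1}. monom (vec_index w i) i)"
  define V where "V = (\<Sum>i\<in>{0..<D}. monom (vec_index w (i + (D - 1))) i)"
  have Uc: "coeff U i = (if i < D - 1 then vec_index w i else 0)" for i
    by (simp add: U_def coeff_sum coeff_monom sum.delta)
  have Vc: "coeff V i = (if i < D then vec_index w (i + (D - 1)) else 0)" for i
    by (simp add: V_def coeff_sum coeff_monom sum.delta)
  have sm: "Polynomial.smult c (monom 1 i * B) = monom c i * B" for c i and B :: "'a poly"
    by (metis mult_smult_left smult_monom mult.right_neutral)
  have row: "disc_row D A (i + (D - 1)) = monom 1 i * pderiv A" for i
    by (simp add: disc_row_def)
  have split: "{0..<n} = {0..<D - 1} \<union> {D - 1..<D + (D - 1)}" "{0..<D - 1} \<inter> {D - 1..<D + (D - 1)} = {}"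
    using deg by (auto simp: n_def)
  have "0 = (\<Sum>i\<in>{0..<n}. Polynomial.smult (vec_index w i) (disc_row D A i))"
    by (rule comb[symmetric])
  also have "\<dots> = (\<Sum>i\<in>{0..<D - 1}. Polynomial.smult (vec_index w i) (disc_row D A i))
      + (\<Sum>i\<in>{0 + (D - 1)..<D + (D - 1)}. Polynomial.smult (vec_index w i) (disc_row D A i))"
    using split by (simp add: sum.union_disjoint)
  also have "(\<Sum>i\<in>{0 + (D - 1)..<D + (D - 1)}. Polynomial.smult (vec_index w i) (disc_row D A i)) = V * pderiv A"
    unfolding sum.shift_bounds_nat_ivl V_def sum_distrib_right row sm ..
  also have "(\<Sum>i\<in>{0..<D - 1}. Polynomial.smult (vec_index w i) (disc_row D A i)) = U * A"
    unfolding U_def sum_distrib_right by (intro sum.cong) (simp_all add: disc_row_def sm)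
  finally have UV: "U * A + V * pderiv A = 0" by simp
  have A0: "A \<noteq> 0" using deg by auto
  obtain S where S: "size S = degree A" "A = Polynomial.smult (lead_coeff A) (\<Prod>x\<in>#S. [:-x, 1:])"
    using alg_closed_imp_factorization[OF A0] by blast
  have "(\<Prod>x\<in>#S. [:-x, 1:]) dvd A" by (subst S(2)) (simp add: dvd_smult)
  then have "S = mset_set (set_mset S)" using squarefree_linear_factors sf by blast
  then have "card (set_mset S) = D" using S(1) deg by (metis size_mset_set)
  have root: "poly A x = 0" if "x \<in># S" for x
    by (subst S(2)) (use that in \<open>simp add: poly_linear_factors_eq_0\<close>)
  have "poly V x = 0" if "x \<in># S" for x
    using arg_cong[OF UV, of "\<lambda>r. poly r x"] root[OF that] sf by auto
  then have "set_mset S \<subseteq> {x. poly V x = 0}" by blast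
  have V0: "V = 0"
  proof (rule ccontr)
    assume "V \<noteq> 0"
    have "D \<le> card {x. poly V x = 0}"
      using card_mono[OF poly_roots_finite[OF \<open>V \<noteq> 0\<close>] \<open>set_mset S \<subseteq> _\<close>] \<open>card (set_mset S) = D\<close> by simp
    also have "\<dots> \<le> degree V" using \<open>V \<noteq> 0\<close> by (rule card_poly_roots_bound)
    also have "\<dots> \<le> D - 1" by (rule degree_le) (use deg in \<open>auto simp: Vc\<close>)
    finally show False using deg by simp
  qed
  then have "U = 0" using UV A0 by simp
  have "vec_index w i = 0" if "i < n" for i
  proof (cases "i < D - 1")
    case True
    then show ?thesis using Uc[of i] \<open>U = 0\<close> by simp
  next
    case False
    then show ?thesis using Vc[of "i - (D - 1)"] V0 that by (simp add: n_def split: if_splits)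
  qed
  then have "w = 0\<^sub>v n" using w(1) by (intro eq_vecI) auto
  then show False using w(2) by simp
qed

lemma int_poly_fun_disc_det:
  assumes "int_poly_family d F"
  shows "int_poly_fun d (\<lambda>a. disc_det D (F a))"
proof -
  define n where "n = 2 * D - 1"
  have r: "int_poly_family d (\<lambda>a. disc_row D (F a) i)" for i
    by (cases "i < D - 1")
      (simp_all add: disc_row_def int_poly_family_mult int_poly_family_const int_poly_family_pderiv assms)
  have e: "disc_det D (F a) = (\<Sum>\<sigma> | \<sigma> permutes {0..<n}. signof \<sigma> * (\<Prod>i = 0..<n. coeff (disc_row D (F a) i) (\<sigma> i)))" for a
  proof -
    have "\<sigma> i < n" if "\<sigma> permutes {0..<n}" "i < n" for \<sigma> i
      using permutes_in_image[OF that(1), of i] that(2) by simp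
    then show ?thesis
      unfolding disc_det_def n_def[symmetric] det_def by (auto intro!: sum.cong prod.cong)
  qed
  show ?thesis unfolding e
    by (intro int_poly_fun_sum int_poly_fun.mult int_poly_fun_prod int_poly_fun.const)
      (use r in \<open>simp add: int_poly_family_def\<close>)
qed

section \<open>A polynomial whose periodic points are all simple\<close>

lemma degree_poly_iter: "degree (poly_iter P m) = degree P ^ m" for P :: "'a::idom poly"
  by (induction m) (simp_all add: poly_iter_Suc degree_pcompose)

lemma poly_pderiv_iter:
  fixes P :: "'a::idom poly"
  shows "poly (pderiv (poly_iter P m)) z = (\<Prod>j<m. poly (pderiv P) ((poly P ^^ j) z))"
  by (induction m) (simp_all add: poly_iter_Suc pderiv_pcompose poly_pcompose poly_poly_iter pderiv_pCons mult_ac)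

text \<open>For large b, all cycles of the conjugate (z + b)^d - b^d of a power map with large
  translation part are repelling or superattracting, so none has multiplier 1.\<close>
lemma (in ultrametric_residue) no_multiplier_1:
  assumes d: "d \<ge> 2" and b: "v b > 1" "of_nat d = (0::'a) \<or> v (of_nat d) * v b ^ (d - 1) > 1"
    and N: "N \<ge> 1" and P: "P = [:b, 1:] ^ d - [:b ^ d:]"
    and z: "(poly P ^^ N) z = z"
  shows "poly (pderiv (poly_iter P N)) z \<noteq> 1"
proof -
  \<comment> \<open>In the coordinate x = z + b the map is x^d + (b - b^d), a power map plus a
    constant of absolute value |b|^d.\<close>
  define x where "x j = (poly P ^^ j) z + b" for j
  have xS: "x (Suc j) = x j ^ d + (b - b ^ d)" for j
    by (simp add: x_def P poly_power add.commute)
  have b_lt: "v b < v (b ^ d)"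
    using power_strict_increasing[of 1 d "v b"] d b(1) by (simp add: v_power)
  have vc: "v (b - b ^ d) = v b ^ d"
    using v_add_eq[of b "- (b ^ d)"] b_lt by (simp add: v_power)
  have big: "v (x (Suc j)) > v (x j)" if "v (x j) > v b" for j
  proof -
    have "v b ^ d < v (x j) ^ d" using that d by (intro power_strict_mono) auto
    then have "v (x (Suc j)) = v (x j) ^ d"
      using v_add_eq[of "b - b ^ d" "x j ^ d"] vc by (simp add: xS v_power add.commute)
    also have "\<dots> > v (x j) ^ 1" using that b(1) d by (intro power_strict_increasing) auto
    finally show ?thesis by simp
  qed
  have small: "v (x (Suc j)) > v b" if "v (x j) < v b" for j
  proof -
    have "v (x j) ^ d < v b ^ d" using that d by (intro power_strict_mono) auto
    then have "v (x (Suc j)) = v b ^ d"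
      using v_add_eq[of "x j ^ d" "b - b ^ d"] vc by (simp add: xS v_power)
    then show ?thesis using b_lt by (simp add: v_power)
  qed
  \<comment> \<open>A periodic orbit stays on |x| = |b|: points outside escape with growing absolute
    value, and points inside are thrown outside in one step. The multiplier then has absolute value
    (|d| |b|^(d-1))^N.\<close>
  have vx: "v (x j) = v b" for j
  proof (rule ccontr)
    assume "v (x j) \<noteq> v b"
    then have j: "v (x (Suc j)) > v b" using big[of j] small[of j] by (cases "v (x j) < v b") auto
    have "v (x (Suc j + Suc k)) > v (x (Suc j))" for k
    proof (induction k)
      case 0
      then show ?case using big[OF j] by simp
    next
      case (Suc k)
      then show ?case using big[of "Suc j + Suc k"] j by simp
    qed
    from this[of "N - 1"] have "v (x (Suc j + N)) > v (x (Suc j))" using N by simp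
    moreover have "x (Suc j + N) = x (Suc j)"
      using funpow_fixed_add[OF z, of "Suc j" 1] by (simp add: x_def)
    ultimately show False by simp
  qed
  have "poly (pderiv P) y = of_nat d * (y + b) ^ (d - 1)" for y
    by (simp add: P pderiv_diff pderiv_power pderiv_pCons poly_power add.commute)
  then have "poly (pderiv (poly_iter P N)) z = (\<Prod>j<N. of_nat d * x j ^ (d - 1))"
    by (simp add: poly_pderiv_iter x_def)
  then have "v (poly (pderiv (poly_iter P N)) z) = (v (of_nat d) * v b ^ (d - 1)) ^ N"
    by (simp add: v_prod v_mult v_power vx)
  moreover have "(v (of_nat d) * v b ^ (d - 1)) ^ N \<noteq> 1"
    using b(2)
  proof
    assume "of_nat d = (0::'a)"
    then show ?thesis using N by (simp add: power_0_left)
  next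
    assume "v (of_nat d) * v b ^ (d - 1) > 1"
    then have "(v (of_nat d) * v b ^ (d - 1)) ^ N > 1" using N by (intro one_less_power) auto
    then show ?thesis by simp
  qed
  ultimately show ?thesis using v_1 by metis
qed

context alg_closed_residue
begin

lemma nondegeneracy_polynomial:
  assumes d: "d \<ge> 2" and N: "N \<ge> 1" and nontriv: "v y > 1"
  shows "\<exists>R :: (nat \<Rightarrow> nat) \<Rightarrow> 'a. is_mpoly_over prime_subfield d R \<and> R \<noteq> (\<lambda>_. 0) \<and>
    (\<forall>a z. mpoly_eval d R a \<noteq> 0 \<and> (poly (\<Sum>i=1..d. monom (a i) i) ^^ N) z = z \<longrightarrow>
       poly (pderiv (poly_iter (\<Sum>i=1..d. monom (a i) i) N)) z \<noteq> 1)"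
proof -
  define P where "P a = (\<Sum>i=1..d. monom (a i) i)" for a :: "nat \<Rightarrow> 'a"
  define A where "A a = poly_iter (P a) N - [:0, 1:]" for a
  define D where "D = d ^ N"
  have D2: "D \<ge> 2" using d N power_increasing[of 1 N d] by (simp add: D_def)
  have "int_poly_family d (\<lambda>a::nat \<Rightarrow> 'a. [:0, 1:])"
    using int_poly_family_const[of d 1] by (simp add: monom_Suc monom_0)
  then have "int_poly_family d A"
    unfolding A_def P_def by (intro int_poly_family_diff int_poly_family_iter)
  then have "int_poly_fun d (\<lambda>a. disc_det D (A a))" by (rule int_poly_fun_disc_det)
  then obtain R where R: "is_mpoly_over prime_subfield d R" "\<And>a. mpoly_eval d R a = disc_det D (A a)"
    using int_poly_fun_imp_mpoly by metis
  have degA: "degree (A a) \<le> D" for a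
  proof -
    have "degree (P a) \<le> d" unfolding P_def by (rule degree_sum_le) (auto intro: order_trans[OF degree_monom_le])
    then have "degree (poly_iter (P a) N) \<le> D" by (simp add: degree_poly_iter D_def power_mono)
    then show ?thesis unfolding A_def using D2 by (intro degree_diff_le) auto
  qed
  have A_root: "poly (A a) z = 0 \<longleftrightarrow> (poly (P a) ^^ N) z = z"
    "poly (pderiv (A a)) z = 0 \<longleftrightarrow> poly (pderiv (poly_iter (P a) N)) z = 1" for a z
    by (simp_all add: A_def poly_poly_iter pderiv_diff pderiv_pCons)
  have "poly (pderiv (poly_iter (P a) N)) z \<noteq> 1"
    if "mpoly_eval d R a \<noteq> 0" "(poly (P a) ^^ N) z = z" for a z
    using disc_det_common_root[OF degA, of a z] D2 that by (auto simp: R(2) A_root)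
  moreover have "R \<noteq> (\<lambda>_. 0)"
  proof
    assume R0: "R = (\<lambda>_. 0)"
    \<comment> \<open>|y|^k exceeds 1/|d|, and one more factor y makes |b| > 1 even for k = 0. If d
      = 0 in K, the quotient is 1/0 = 0 by convention, and all multipliers are 0.\<close>
    obtain k where k: "1 / v (of_nat d) < v y ^ k" using real_arch_pow[OF nontriv] by blast
    define b where "b = y ^ Suc k"
    have b1: "v b > 1" unfolding b_def v_power by (intro one_less_power nontriv) simp
    have "v y ^ k \<le> v b" unfolding b_def v_power using nontriv by (intro power_increasing) auto
    moreover have "v b ^ 1 \<le> v b ^ (d - 1)" using b1 d by (intro power_increasing) auto
    ultimately have lt: "1 / v (of_nat d) < v b ^ (d - 1)" using k by simp
    have b2: "of_nat d = (0::'a) \<or> v (of_nat d) * v b ^ (d - 1) > 1"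
    proof (cases "of_nat d = (0::'a)")
      case False
      then have "v (of_nat d) > 0" using v_nonneg[of "of_nat d"] v_eq_0[of "of_nat d"] by linarith
      then show ?thesis using lt by (simp add: field_simps)
    qed simp
    define Q where "Q = [:b, 1:] ^ d - [:b ^ d:]"
    \<comment> \<open>These coefficients may lie outside O_K: one nonzero value anywhere in K shows
      that \<open>R\<close> is a nonzero polynomial.\<close>
    define a where "a = coeff Q"
    have "degree ([:b, 1:] ^ d) = d" by (simp add: degree_power_eq)
    then have degQ: "degree Q = d"
      unfolding Q_def diff_conv_add_uminus using d by (subst degree_add_eq_left) auto
    have "coeff Q 0 = 0" by (simp add: Q_def poly_power flip: poly_0_coeff_0)
    then have PQ: "P a = Q"
      using degQ by (auto simp: poly_eq_iff P_def a_def coeff_sum coeff_monom sum.delta coeff_eq_0 not_le)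
    have "degree (poly_iter Q N) = D" by (simp add: degree_poly_iter degQ D_def)
    then have "degree (A a) = D"
      unfolding A_def PQ diff_conv_add_uminus using D2 by (subst degree_add_eq_left) auto
    moreover have "poly (pderiv (A a)) z \<noteq> 0" if "poly (A a) z = 0" for z
      using no_multiplier_1[OF d b1 b2 N Q_def, of z] that unfolding A_root PQ by simp
    ultimately have "disc_det D (A a) \<noteq> 0" using D2 by (intro disc_det_nonzero) auto
    then show False using R(2)[of a] by (simp add: R0 mpoly_eval_def)
  qed
  ultimately show ?thesis using R(1) unfolding P_def by (intro exI[of _ R]) simp
qed

end

section \<open>Combination of both directions, including the trivial absolute value\<close>

lemma (in ultrametric_residue) trivial_value:
  assumes "\<And>y. v y \<le> 1" "v x < 1"
  shows "x = 0"
proof (rule ccontr)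
  assume "x \<noteq> 0"
  then have "v x > 0" using v_nonneg[of x] v_eq_0[of x] by linarith
  then have "v (1 / x) > 1" using assms(2) by (simp add: v_divide less_divide_eq)
  then show False using assms(1)[of "1 / x"] by simp
qed

text \<open>\<open>ram_index\<close> is a \<open>LEAST\<close>, with a meaningless value at the
  identity. But an identity iterate stays the identity at the next level and gives the same value
  there, which contradicts strict growth; so the prescribed indices are genuine.\<close>

lemma ram_number_of_strict_ram_index:
  fixes g :: "'k::field poly"
  assumes g: "coeff g 0 = 0" "has_order (coeff g 1) q"
    and r: "\<And>n. ram_index p (poly_iter g q) n = r n" "r n < r (Suc n)"
  shows "ram_number (fps_of_poly (poly_iter g (q * p ^ n))) (r n)"
proof -
  have h: "coeff (poly_iter g q) 0 = 0" "coeff (poly_iter g q) 1 = 1"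
    using g poly_iter_coeff_0 poly_iter_coeff_1[OF g(1), of q] by (auto simp: has_order_def)
  have "poly_iter (poly_iter g q) (p ^ n) \<noteq> [:0, 1:]"
  proof
    assume i: "poly_iter (poly_iter g q) (p ^ n) = [:0, 1:]"
    then have "poly_iter (poly_iter g q) (p ^ Suc n) = [:0, 1:]"
      using poly_iter_fixed[OF i, of p] by (simp add: mult.commute)
    then have "ram_index p (poly_iter g q) n = ram_index p (poly_iter g q) (Suc n)"
      using i by (simp add: ram_index_def)
    then show False using r(1)[of n] r(1)[of "Suc n"] r(2) by simp
  qed
  then show ?thesis
    using ram_number_ram_index[OF h] r(1) by (metis poly_iter_mult)
qed

theorem theoremB:
  fixes v :: "'a::alg_closed_field \<Rightarrow> real"
    and red :: "'a \<Rightarrow> 'k::field"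
    and p q :: nat
  assumes "ultrametric_abs v"
    and "residue_map v red"
    and "prime p"
    and "CHAR('k) = p"
    and "q \<ge> 1"
    and "\<not> p dvd q"
  shows
   "(\<forall>(P :: 'a poly) n z0.
        v (coeff P 1) = 1 \<and> has_order (red (coeff P 1)) q \<and> n \<ge> 1 \<and>
        coeff P 0 = 0 \<and> (\<forall>i. v (coeff P i) \<le> 1) \<and>
        optimal_point v P q p n z0 \<longrightarrow>
          (\<forall>w. v w < 1 \<and> min_period (poly P) w (q * p ^ n) \<longrightarrow>
                 (\<exists>j. w = (poly P ^^ j) z0)) \<and>
          (odd p \<longrightarrow> minimally_ramified p q (map_poly red P)) \<and>
          (p = 2 \<and> n \<ge> 2 \<longrightarrow>
             minimally_ramified p q (map_poly red P) \<or>
             almost_minimally_ramified q (map_poly red P)))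
    \<and>
    (\<forall>(g :: 'k poly) \<gamma>.
        has_order \<gamma> q \<and> coeff g 0 = 0 \<and> coeff g 1 = \<gamma> \<and>
        (if odd p then minimally_ramified p q g
         else minimally_ramified p q g \<or> almost_minimally_ramified q g) \<longrightarrow>
        (\<forall>n d. n \<ge> 1 \<and> d \<ge> max (degree g) p \<longrightarrow>
           (\<exists>R :: (nat \<Rightarrow> nat) \<Rightarrow> 'a.
              is_mpoly_over prime_subfield d R \<and> R \<noteq> (\<lambda>_. 0) \<and>
              (\<forall>a :: nat \<Rightarrow> 'a.
                 (\<forall>i\<in>{1..d}. v (a i) \<le> 1) \<and>
                 map_poly red (\<Sum>i=1..d. monom (a i) i) = g \<and>
                 mpoly_eval d R a \<noteq> 0 \<longrightarrow>
                 has_optimal_cycle v (\<Sum>i=1..d. monom (a i) i) q p n))))"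
proof -
  interpret alg_closed_residue v red by unfold_locales (use assms in auto)
  note p = \<open>prime p\<close> \<open>CHAR('k) = p\<close> \<open>\<not> p dvd q\<close>
  have p2: "p \<ge> 2" using p(1) by (rule prime_ge_2_nat)
  show ?thesis
  proof (intro conjI allI impI; elim conjE)
    fix P :: "'a poly" and n z0 w
    assume "coeff P 0 = 0" "\<forall>i. v (coeff P i) \<le> 1" "has_order (red (coeff P 1)) q" "n \<ge> 1"
      "optimal_point v P q p n z0" "v w < 1" "min_period (poly P) w (q * p ^ n)"
    then show "\<exists>j. w = (poly P ^^ j) z0"
      using optimal_imp_unique_and_gap(1)[OF _ _ _ p] by (simp add: integral_poly_def)
  next
    fix P :: "'a poly" and n z0
    assume "coeff P 0 = 0" "\<forall>i. v (coeff P i) \<le> 1" "has_order (red (coeff P 1)) q" "n \<ge> 1"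
      "optimal_point v P q p n z0"
    then obtain i where i: "ram_number (fps_iter (fps_of_poly (red_poly P)) (q * p ^ (n - 1))) i"
        "ram_number (fps_iter (fps_of_poly (red_poly P)) (q * p ^ n)) (i + q * p ^ n)"
      and g: "fps_nth (fps_of_poly (red_poly P)) 0 = 0" "has_order (fps_nth (fps_of_poly (red_poly P)) 1) q"
      using optimal_imp_unique_and_gap(2)[OF _ _ _ p, of P n z0] fps_of_poly_iter[of "red_poly P"]
      by (auto simp: integral_poly_def)
    have ri: "ram_index p (poly_iter (red_poly P) q) m = j"
      if "ram_number (fps_iter (fps_of_poly (red_poly P)) (q * p ^ m)) j" for m j
      using that fps_of_poly_iter[of "red_poly P"] \<open>coeff P 0 = 0\<close>
      by (intro ram_index_eq) (simp flip: poly_iter_mult)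
    have mr: "minimally_ramified p q (red_poly P)" 
      if "\<forall>m. ram_number (fps_iter (fps_of_poly (red_poly P)) (q * p ^ m)) (q * geo p m)"
      using that ri unfolding minimally_ramified_def by (simp add: geo_closed[OF p2])
    note alt = ram_number_gap_imp_minimal_general[OF g p \<open>n \<ge> 1\<close> _ i]
    show "minimally_ramified p q (map_poly red P)" if "odd p"
      using alt mr that by (cases "p = 2") auto
    show "minimally_ramified p q (map_poly red P) \<or> almost_minimally_ramified q (map_poly red P)"
      if "p = 2" "n \<ge> 2"
      using alt mr ri that unfolding almost_minimally_ramified_def by (auto simp: mult.commute)
  next
    fix g :: "'k poly" and \<gamma> and n d :: nat
    assume \<gamma>: "has_order \<gamma> q" and g: "coeff g 0 = 0" "coeff g 1 = \<gamma>"
      and mr: "if odd p then minimally_ramified p q g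
         else minimally_ramified p q g \<or> almost_minimally_ramified q g"
      and n: "n \<ge> 1" and d: "d \<ge> max (degree g) p"
    let ?N = "q * p ^ n"
    define P where "P a = (\<Sum>i=1..d. monom (a i) i)" for a :: "nat \<Rightarrow> 'a"
    have d2: "d \<ge> 2" using d p2 by simp
    obtain l where l: "n = Suc l" using n by (cases n) auto
    have cP: "coeff (P a) i = (if i \<in> {1..d} then a i else 0)" for a i
      by (simp add: P_def coeff_sum coeff_monom sum.delta)
    have q: "q \<ge> 1" using \<gamma> by (simp add: has_order_def)
    have ord: "has_order (coeff g 1) q" using \<gamma> g by simp
    have "p = 2" if "even p" using that p(1) primes_dvd_imp_eq two_is_prime_nat by blast
    then consider "minimally_ramified p q g" | "p = 2" "almost_minimally_ramified q g"
      using mr by (auto split: if_splits)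
    then obtain i where gap: "ram_number (fps_of_poly (poly_iter g (q * p ^ (n - 1)))) i"
        "ram_number (fps_of_poly (poly_iter g ?N)) (i + ?N)"
    proof cases
      case 1
      then have r: "ram_index p (poly_iter g q) m = q * geo p m" for m
        unfolding minimally_ramified_def geo_closed[OF p2] by blast
      have lt: "q * geo p m < q * geo p (Suc m)" for m
        using q p2 by (simp only: geo_Suc_power) simp
      have rn: "ram_number (fps_of_poly (poly_iter g (q * p ^ m))) (q * geo p m)" for m
        using g(1) ord r lt by (rule ram_number_of_strict_ram_index)
      show ?thesis
        using that[of "q * geo p l"] rn[of l] rn[of n] by (simp only: l geo_Suc_power) (simp add: distrib_left)
    next
      case 2
      then have r: "ram_index 2 (poly_iter g q) m = 2 ^ (m + 1) * q" for m
        unfolding almost_minimally_ramified_def by blast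
      have lt: "2 ^ (m + 1) * q < 2 ^ (Suc m + 1) * q" for m using q by simp
      have rn: "ram_number (fps_of_poly (poly_iter g (q * 2 ^ m))) (2 ^ (m + 1) * q)" for m
        using g(1) ord r lt by (rule ram_number_of_strict_ram_index)
      show ?thesis
        using that[of "2 ^ (l + 1) * q"] rn[of l] rn[of n] by (simp add: l 2(1) algebra_simps)
    qed
    show "\<exists>R :: (nat \<Rightarrow> nat) \<Rightarrow> 'a.
              is_mpoly_over prime_subfield d R \<and> R \<noteq> (\<lambda>_. 0) \<and>
              (\<forall>a :: nat \<Rightarrow> 'a.
                 (\<forall>i\<in>{1..d}. v (a i) \<le> 1) \<and>
                 map_poly red (\<Sum>i=1..d. monom (a i) i) = g \<and>
                 mpoly_eval d R a \<noteq> 0 \<longrightarrow>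
                 has_optimal_cycle v (\<Sum>i=1..d. monom (a i) i) q p n)"
    proof (cases "\<exists>y. v y > 1")
      case True
      then obtain y where y: "v y > 1" ..
      have "?N \<ge> 1" using q p2 by simp
      from nondegeneracy_polynomial[OF d2 this y] obtain R :: "(nat \<Rightarrow> nat) \<Rightarrow> 'a"
        where R: "is_mpoly_over prime_subfield d R" "R \<noteq> (\<lambda>_. 0)"
          "\<forall>a z. mpoly_eval d R a \<noteq> 0 \<and> (poly (P a) ^^ ?N) z = z \<longrightarrow>
            poly (pderiv (poly_iter (P a) ?N)) z \<noteq> 1"
        unfolding P_def by (elim exE conjE)
      have "has_optimal_cycle v (P a) q p n"
        if a: "\<forall>i\<in>{1..d}. v (a i) \<le> 1" "red_poly (P a) = g" "mpoly_eval d R a \<noteq> 0" for a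
      proof (rule squarefree_gap_imp_optimal[OF _ _ _ p n])
        show "integral_poly (P a)" using a(1) by (simp add: integral_poly_def cP)
        show "coeff (P a) 0 = 0" by (simp add: cP)
        show "has_order (red (coeff (P a) 1)) q" using ord coeff_red_poly[of "P a" 1] a(2) by simp
        show "ram_number (fps_of_poly (poly_iter (red_poly (P a)) (q * p ^ (n - 1)))) i"
          "ram_number (fps_of_poly (poly_iter (red_poly (P a)) ?N)) (i + ?N)"
          using gap a(2) by simp_all
      qed (use R(3) a(3) in simp)
      then show ?thesis using R(1,2) unfolding P_def by (intro exI[of _ R]) simp
    next
      case False
      then have triv: "v y \<le> 1" for y by (simp add: not_less)
      \<comment> \<open>For the trivial absolute value the open disk is {0} and no cycle of period
        at least 2 fits in it. The polynomial \<alpha>_1^q - 1 is nonzero, with value -1 at the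
        origin, but vanishes at every lift of g, so the required implication holds
        vacuously.\<close>
      have "int_poly_fun d (\<lambda>a. a 1 ^ q - 1 :: 'a)"
        by (intro int_poly_fun_diff int_poly_fun_power int_poly_fun_1 int_poly_fun.var) (use d2 in simp)
      from int_poly_fun_imp_mpoly[OF this] obtain R :: "(nat \<Rightarrow> nat) \<Rightarrow> 'a"
        where R1: "is_mpoly_over prime_subfield d R" and R2: "\<forall>a. mpoly_eval d R a = a 1 ^ q - 1"
        by (elim exE conjE)
      note R = R1 R2[rule_format]
      have "R \<noteq> (\<lambda>_. 0)"
      proof
        assume "R = (\<lambda>_. 0)"
        then have "(0::'a) ^ q - 1 = 0" using R(2)[of "\<lambda>_. 0"] by (simp add: mpoly_eval_def)
        then show False using q by (simp add: power_0_left)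
      qed
      moreover have "mpoly_eval d R a = 0" if "red_poly (P a) = g" for a
      proof -
        have "red (a 1) = \<gamma>" using coeff_red_poly[of "P a" 1] that g d2 by (simp add: cP)
        then have "red (a 1 ^ q) = 1" using \<gamma> triv by (simp add: red_power has_order_def)
        then have "red (a 1 ^ q - 1) = 0"
          using red_add[of "a 1 ^ q - 1" 1] triv by simp
        then have "v (a 1 ^ q - 1) < 1" using red_eq_0[OF triv, of "a 1 ^ q - 1"] by simp
        then have "a 1 ^ q - 1 = 0" by (rule trivial_value[OF triv])
        then show ?thesis by (simp only: R(2))
      qed
      ultimately show ?thesis using R(1) unfolding P_def by (intro exI[of _ R]) auto
    qed
  qed
qed

end
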